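(* Let $\mathbf{P}$ be the universal homogeneous partial order, i.e. the (unique up to isomorphism) countable partial order that is homogeneous (every isomorphism between finite substructures extends to an automorphism of $\mathbf{P}$) and into which every countable partial order embeds. Then $\mathbf{P}$ has finite big Ramsey degrees.
   Context: Partial orders are viewed as relational structures with one binary relation $\leq$. An embedding $f\colon \mathbf{A}\to\mathbf{B}$ of relational structures is an injective map such that for every relation symbol $R$ of arity $r$ and all $v_1,\dots,v_r$, $(v_1,\dots,v_r)\in R_{\mathbf{A}}$ iff $(f(v_1),\dots,f(v_r))\in R_{\mathbf{B}}$. For structures $\mathbf{A},\mathbf{B}$, $\binom{\mathbf{B}}{\mathbf{A}}$ denotes the set of all embeddings $\mathbf{A}\to\mathbf{B}$. For structures $\mathbf{A},\mathbf{B},\mathbf{C}$ and integers $r,l$, $\mathbf{C}\longrightarrow(\mathbf{B})^{\mathbf{A}}_{r,l}$ means: for every colouring $\chi$ of $\binom{\mathbf{C}}{\mathbf{A}}$ with $r$ colours there is an embedding $f\colon\mathbf{B}\to\mathbf{C}$ such that $\chi$ attains at most $l$ values on $\{f\circ g: g\in\binom{\mathbf{B}}{\mathbf{A}}\}$. For a countably infinite structure $\mathbf{B}$ and a finite substructure $\mathbf{A}$, the big Ramsey degree of $\mathbf{A}$ in $\mathbf{B}$ is the least $L\in\omega\cup\{\omega\}$ such that $\mathbf{B}\longrightarrow(\mathbf{B})^{\mathbf{A}}_{r,L}$ for every $r\in\omega$. $\mathbf{B}$ has finite big Ramsey degrees if the big Ramsey degree of every finite substructure $\mathbf{A}$ of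 $\mathbf{B}$ in $\mathbf{B}$ is finite. *)

theory Defs
  imports "HOL-Library.FuncSet" "HOL-Library.Countable_Set" "HOL-Library.Extended_Nat"
begin

record 'a binstruct =
  universe :: "'a set"
  brel :: "('a \<times> 'a) set"

definition partial_order :: "'a binstruct \<Rightarrow> bool" where
  "partial_order A \<longleftrightarrow> partial_order_on (universe A) (brel A)"

definition substructure :: "'a binstruct \<Rightarrow> 'a binstruct \<Rightarrow> bool" where
  "substructure A B \<longleftrightarrow> universe A \<subseteq> universe B \<and> brel A = brel B \<inter> universe A \<times> universe A"

text \<open>Maps between universes are extensional functions, so that equal maps are equal terms
  and a colouring of embeddings is a colouring of genuine maps.\<close>

definition embeddings :: "'a binstruct \<Rightarrow> 'b binstruct \<Rightarrow> ('a \<Rightarrow> 'b) set" where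
  "embeddings A B = {f \<in> universe A \<rightarrow>\<^sub>E universe B. inj_on f (universe A) \<and>
     (\<forall>x\<in>universe A. \<forall>y\<in>universe A. (x, y) \<in> brel A \<longleftrightarrow> (f x, f y) \<in> brel B)}"

definition isomorphisms :: "'a binstruct \<Rightarrow> 'b binstruct \<Rightarrow> ('a \<Rightarrow> 'b) set" where
  "isomorphisms A B = {f \<in> embeddings A B. f ` universe A = universe B}"

definition homogeneous :: "'a binstruct \<Rightarrow> bool" where
  "homogeneous P \<longleftrightarrow>
     (\<forall>A B. substructure A P \<longrightarrow> finite (universe A) \<longrightarrow> substructure B P \<longrightarrow> finite (universe B) \<longrightarrow>
       (\<forall>f\<in>isomorphisms A B. \<exists>g\<in>isomorphisms P P. \<forall>x\<in>universe A. g x = f x))"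

text \<open>A definition cannot quantify over all types; every countable structure has an isomorphic
  copy with universe a set of natural numbers, so it suffices to quantify over those. The lemma
  \<open>universal_embeds\<close> below recovers arbitrary types.\<close>

definition universal_for_countable_orders :: "'a binstruct \<Rightarrow> bool" where
  "universal_for_countable_orders P \<longleftrightarrow>
     (\<forall>Q :: nat binstruct. partial_order Q \<longrightarrow> embeddings Q P \<noteq> {})"

definition universal_homogeneous_partial_order :: "'a binstruct \<Rightarrow> bool" where
  "universal_homogeneous_partial_order P \<longleftrightarrow>
     partial_order P \<and> countable (universe P) \<and> homogeneous P \<and> universal_for_countable_orders P"

text \<open>The bound is an \<^typ>\<open>enat\<close> because big Ramsey degrees range over the natural numbers
  together with infinity. The counted set of values is finite, being contained in \<open>{..<r}\<close>,
  so \<^const>\<open>card\<close> is its true cardinality.\<close>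

definition arrows ::
  "'c binstruct \<Rightarrow> 'b binstruct \<Rightarrow> 'a binstruct \<Rightarrow> nat \<Rightarrow> enat \<Rightarrow> bool" where
  "arrows C B A r l \<longleftrightarrow>
     (\<forall>\<chi> \<in> embeddings A C \<rightarrow> {..<r}. \<exists>f\<in>embeddings B C.
        enat (card (\<chi> ` {compose (universe A) f g | g. g \<in> embeddings A B})) \<le> l)"

definition big_ramsey_degree :: "'a binstruct \<Rightarrow> 'b binstruct \<Rightarrow> enat" where
  "big_ramsey_degree A B = (LEAST L. \<forall>r. arrows B B A r L)"

definition finite_big_ramsey_degrees :: "'a binstruct \<Rightarrow> bool" where
  "finite_big_ramsey_degrees B \<longleftrightarrow>
     (\<forall>A. substructure A B \<longrightarrow> finite (universe A) \<longrightarrow> big_ramsey_degree A B < \<infinity>)"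

lemma universal_embeds:
  fixes P :: "'a binstruct" and Q :: "'b binstruct"
  assumes "universal_for_countable_orders P" and Q: "partial_order Q" and c: "countable (universe Q)"
  shows "embeddings Q P \<noteq> {}"
proof -
  define h where "h = to_nat_on (universe Q)"
  have inj: "inj_on h (universe Q)"
    unfolding h_def using c by (rule inj_on_to_nat_on)
  define N where "N = \<lparr>universe = h ` universe Q, brel = map_prod h h ` brel Q\<rparr>"
  have po: "partial_order_on (universe Q) (brel Q)"
    using Q by (simp add: partial_order_def)
  then have sub: "brel Q \<subseteq> universe Q \<times> universe Q"
    by (auto simp: partial_order_on_def preorder_on_def)
  have rel: "(h x, h y) \<in> brel N \<longleftrightarrow> (x, y) \<in> brel Q" if "x \<in> universe Q" "y \<in> universe Q" for x y
    using that sub inj by (auto simp: N_def dest: inj_onD)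
  have relsub: "brel N \<subseteq> universe N \<times> universe N"
    using sub by (auto simp: N_def)
  have "refl_on (universe N) (brel N)"
    using po rel by (auto simp: partial_order_on_def preorder_on_def refl_on_def N_def)
  moreover have "trans (brel N)"
  proof (rule transI)
    fix a b d assume ab: "(a, b) \<in> brel N" and bd: "(b, d) \<in> brel N"
    obtain x y z where xyz: "x \<in> universe Q" "y \<in> universe Q" "z \<in> universe Q" "a = h x" "b = h y" "d = h z"
    proof -
      have "a \<in> h ` universe Q" "b \<in> h ` universe Q" "d \<in> h ` universe Q"
        using relsub ab bd unfolding N_def by auto
      then show ?thesis
        using that by blast
    qed
    have "trans (brel Q)"
      using po by (simp add: partial_order_on_def preorder_on_def)
    then show "(a, d) \<in> brel N"
      using ab bd xyz rel by (metis transD)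
  qed
  moreover have "antisym (brel N)"
  proof (rule antisymI)
    fix a b assume ab: "(a, b) \<in> brel N" and ba: "(b, a) \<in> brel N"
    obtain x y where xy: "x \<in> universe Q" "y \<in> universe Q" "a = h x" "b = h y"
    proof -
      have "a \<in> h ` universe Q" "b \<in> h ` universe Q"
        using relsub ab unfolding N_def by auto
      then show ?thesis
        using that by blast
    qed
    have "antisym (brel Q)"
      using po by (simp add: partial_order_on_def)
    then show "a = b"
      using ab ba xy rel by (metis antisymD)
  qed
  ultimately have "partial_order N"
    using relsub by (simp add: partial_order_def partial_order_on_def preorder_on_def)
  then obtain e where e: "e \<in> embeddings N P"
    using assms(1) by (auto simp: universal_for_countable_orders_def)
  have un: "universe N = h ` universe Q"
    by (simp add: N_def)
  have "compose (universe Q) e h \<in> embeddings Q P"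
    using e rel inj un by (auto simp: embeddings_def compose_def inj_on_def PiE_iff)
  then show ?thesis
    by blast
qed

text \<open>The set whose least element is taken is never empty: \<open>\<infinity>\<close> always belongs to it.\<close>

lemma arrows_infinity: "arrows B B A r \<infinity>"
proof -
  have "restrict id (universe B) \<in> embeddings B B"
    by (auto simp: embeddings_def inj_on_def)
  then show ?thesis
    by (auto simp: arrows_def)
qed

end

theory Submission imports Defs begin

text \<open>
  Words over the letters \<open>L < X < R\<close> are ordered by \<open>v < w\<close> iff \<open>(v i, w i) = (L, R)\<close> for some
  \<open>i\<close> and \<open>v j \<le> w j\<close> for all \<open>j < i\<close> (Hubicka). Every countable order embeds into this one, and
  so the two orders embed into each other; substitution into an infinite parameter word is a
  self-embedding of the order of words. Any \<open>n\<close> words are substitution instances of a single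
  finite parameter word whose number of parameters depends on \<open>n\<close> only. By the Carlson--Simpson
  theorem, some infinite parameter word makes the colour of a tuple depend only on the finitely
  many possible data substituted into that finite parameter word.

  The Carlson--Simpson theorem itself is obtained by combinatorial forcing: fusion decides for
  each finite prefix whether a colour class meets all continuations or none, and a left-variable
  Hales--Jewett theorem extends undefeated prefixes.
\<close>

text \<open>The obstacle is uniformity: a tuple may consist of words of any lengths that branch
  anywhere, yet its colour must come from a finite list. At each position a tuple of
  \<open>n\<close> words shows one of at most \<open>4 ^ n\<close> columns (each word shows one of
  three letters or has already ended), and equal columns share a parameter; this is the bound
  \<open>B\<close> on the dimension of the envelope. Substitution into an infinite parameter word
  \<open>W\<close> commutes with instantiating the envelope \<open>U\<close>
  (\<open>app_finite_app\<close>), so the image of the tuple is described by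
  \<open>app 3 W U\<close> and the same data. For fixed data the colour is thus a colouring of
  finite parameter words of fixed dimension, and one \<open>W\<close> serves all data.

  Parameters already placed have to be treated as constants: after the \<open>n\<close>-th one,
  continuations live over \<open>k + n + 1\<close> letters. This is why the Ramsey theorems are
  proved for alphabets of every size although the order of words has three letters.\<close>

abbreviation word :: "nat \<Rightarrow> nat list \<Rightarrow> bool" where
  "word k w \<equiv> set w \<subseteq> {..<k}"

text \<open>The letters below \<open>k\<close> are constants, and \<open>k + i\<close> is the \<open>i\<close>-th parameter.\<close>

definition subst :: "nat \<Rightarrow> nat list \<Rightarrow> nat \<Rightarrow> nat" where
  "subst k u i = (if i < k then i else u ! (i - k))"

lemma subst_less [simp]: "i < k \<Longrightarrow> subst k u i = i"
  by (simp add: subst_def)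

lemma subst_var [simp]: "subst k u (k + i) = u ! i"
  by (simp add: subst_def)

lemma map_subst_word [simp]: "word k w \<Longrightarrow> map (subst k u) w = w"
  by (rule map_idI) auto

lemma subst_bound:
  assumes "i < k + length u" "word m u" "k \<le> m"
  shows "subst k u i < m"
proof (cases "i < k")
  case False
  then have "u ! (i - k) \<in> set u" using assms by (intro nth_mem) auto
  with assms(2) have "u ! (i - k) < m" by blast
  then show ?thesis using False by (simp add: subst_def)
qed (use assms in auto)

lemma word_map_subst:
  assumes "word (k + length u) w" "word m u" "k \<le> m"
  shows "word m (map (subst k u) w)"
  using assms subst_bound[OF _ assms(2,3)] by auto

lemma finite_words: "finite {w. word k w \<and> length w = n}"
  by (rule finite_lists_length_eq) simp

lemma finite_words_le: "finite {w. word k w \<and> length w \<le> n}"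
  by (rule finite_lists_length_le) simp

section \<open>The Hales--Jewett theorem and a left-variable variant\<close>

definition mono_line :: "nat \<Rightarrow> nat \<Rightarrow> (nat list \<Rightarrow> 'c) \<Rightarrow> bool" where
  "mono_line k n \<chi> \<longleftrightarrow> (\<exists>l c. word (Suc k) l \<and> length l = n \<and> k \<in> set l \<and>
     (\<forall>a<k. \<chi> (map (subst k [a]) l) = c))"

text \<open>Fixed to \<open>nat\<close> colours because a definition cannot range over colour types.
  \<open>hales_jewett_any_colours\<close> removes the restriction; product arguments colour a word
  by the whole function of the colours of its extensions.\<close>

definition hales_jewett :: "nat \<Rightarrow> nat \<Rightarrow> bool" where
  "hales_jewett k r \<longleftrightarrow> (\<exists>n. \<forall>\<chi>::nat list \<Rightarrow> nat.
     (\<forall>w. word k w \<and> length w = n \<longrightarrow> \<chi> w < r) \<longrightarrow> mono_line k n \<chi>)"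

lemma hales_jewett_any_colours:
  fixes C :: "'c set"
  assumes "\<And>r. hales_jewett k r" "finite C"
  shows "\<exists>n. \<forall>\<chi>. (\<forall>w. word k w \<and> length w = n \<longrightarrow> \<chi> w \<in> C) \<longrightarrow> mono_line k n \<chi>"
proof -
  obtain h where h: "bij_betw h C {0..<card C}"
    using ex_bij_betw_finite_nat[OF \<open>finite C\<close>] by blast
  obtain n where n: "\<forall>\<chi>::nat list \<Rightarrow> nat. (\<forall>w. word k w \<and> length w = n \<longrightarrow> \<chi> w < card C)
      \<longrightarrow> mono_line k n \<chi>"
    using assms(1)[of "card C"] unfolding hales_jewett_def by blast
  have "mono_line k n \<chi>" if \<chi>: "\<forall>w. word k w \<and> length w = n \<longrightarrow> \<chi> w \<in> C" for \<chi>
  proof -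
    have "mono_line k n (h \<circ> \<chi>)"
      using \<chi> h by (intro n[rule_format]) (auto simp: bij_betw_def)
    then obtain l c where l: "word (Suc k) l" "length l = n" "k \<in> set l"
      and c: "\<And>a. a < k \<Longrightarrow> h (\<chi> (map (subst k [a]) l)) = c"
      by (auto simp: mono_line_def)
    have in_C: "\<chi> (map (subst k [a]) l) \<in> C" if "a < k" for a
      using l that by (intro \<chi>[rule_format] conjI word_map_subst) auto
    have "\<chi> (map (subst k [a]) l) = inv_into C h c" if "a < k" for a
      using in_C[OF that] c[OF that] h by (metis bij_betw_inv_into_left)
    with l show ?thesis by (auto simp: mono_line_def)
  qed
  then show ?thesis by blast
qed

text \<open>Colour focusing: the lines indexed by the set \<open>Cs\<close> all pass through \<open>f\<close> when the
  variable is replaced by the last letter.\<close>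

definition focused :: "nat \<Rightarrow> nat \<Rightarrow> nat set \<Rightarrow> (nat list \<Rightarrow> nat) \<Rightarrow> bool" where
  "focused k n Cs \<chi> \<longleftrightarrow> (\<exists>f. word (Suc k) f \<and> length f = n \<and>
     (\<forall>c\<in>Cs. \<exists>l. word (Suc (Suc k)) l \<and> length l = n \<and> Suc k \<in> set l \<and>
        map (subst (Suc k) [k]) l = f \<and> (\<forall>a<k. \<chi> (map (subst (Suc k) [a]) l) = c)))"

text \<open>Induction on the number of focused colours, with words split into two blocks.
  Hales--Jewett for \<open>k\<close> gives a line in the first block along which the induced
  colouring of the second block does not change. The lines already focused there keep their colours
  when moved together with this line, and moving the first block alone, with the second fixed at the
  focus, adds the colour of the focus.\<close>

lemma colour_focusing:
  assumes HJ: "\<And>r. hales_jewett k r"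
  shows "j \<le> r \<Longrightarrow> \<exists>n. \<forall>\<chi>. (\<forall>w. word (Suc k) w \<and> length w = n \<longrightarrow> \<chi> w < r) \<longrightarrow>
    mono_line (Suc k) n \<chi> \<or> (\<exists>Cs\<subseteq>{..<r}. card Cs = j \<and> focused k n Cs \<chi>)"
proof (induction j)
  case 0
  have "focused k 1 {} \<chi>" for \<chi>
    by (auto simp: focused_def intro!: exI[of _ "[0]"])
  then show ?case
    by (intro exI[of _ 1]) (auto intro!: exI[of _ "{}"])
next
  case (Suc j)
  then obtain n where n: "\<forall>\<chi>. (\<forall>w. word (Suc k) w \<and> length w = n \<longrightarrow> \<chi> w < r) \<longrightarrow>
      mono_line (Suc k) n \<chi> \<or> (\<exists>Cs\<subseteq>{..<r}. card Cs = j \<and> focused k n Cs \<chi>)"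
    using Suc_leD by blast
  let ?X = "{x. word (Suc k) x \<and> length x = n}"
  have "finite (?X \<rightarrow>\<^sub>E {..<r})"
    by (intro finite_PiE finite_words) auto
  from hales_jewett_any_colours[OF HJ this] obtain m where m: "\<forall>\<chi>. (\<forall>w. word k w \<and> length w = m \<longrightarrow> \<chi> w \<in> ?X \<rightarrow>\<^sub>E {..<r}) \<longrightarrow>
      mono_line k m \<chi>"
    ..
  have "mono_line (Suc k) (m + n) \<chi> \<or> (\<exists>Cs\<subseteq>{..<r}. card Cs = Suc j \<and> focused k (m + n) Cs \<chi>)"
    if \<chi>: "\<forall>w. word (Suc k) w \<and> length w = m + n \<longrightarrow> \<chi> w < r" for \<chi>
  proof -
    have "mono_line k m (\<lambda>y. \<lambda>x\<in>?X. \<chi> (y @ x))"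
      using \<chi> by (intro m[rule_format]) (auto simp: less_Suc_eq subset_iff)
    then obtain l g where l: "word (Suc k) l" "length l = m" "k \<in> set l"
      and g: "\<And>a. a < k \<Longrightarrow> (\<lambda>x\<in>?X. \<chi> (map (subst k [a]) l @ x)) = g"
      by (auto simp: mono_line_def)
    define L where "L a = map (subst k [a]) l" for a
    \<comment> \<open>For \<open>a < k\<close> the second block is coloured in the same way after
      every \<open>L a\<close>, so \<open>L 0\<close> represents them all.\<close>
    define \<chi>' where "\<chi>' x = \<chi> (L 0 @ x)" for x
    have L: "word (Suc k) (L a)" "length (L a) = m" if "a \<le> k" for a
      using l that unfolding L_def by (intro word_map_subst, auto)
    have eq: "\<chi> (L a @ x) = \<chi>' x" if "a < k" "x \<in> ?X" for a x
    proof -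
      have "0 < k" using that by simp
      have "(\<lambda>x\<in>?X. \<chi> (L a @ x)) = (\<lambda>x\<in>?X. \<chi> (L 0 @ x))"
        unfolding L_def by (rule trans[OF g[OF \<open>a < k\<close>] g[OF \<open>0 < k\<close>, symmetric]])
      from fun_cong[OF this, of x] show ?thesis using that by (simp add: \<chi>'_def)
    qed
    \<comment> \<open>In the larger alphabet \<open>k\<close> is a letter, so the variable is
      renamed to \<open>Suc k\<close>.\<close>
    define l' where "l' = map (\<lambda>i. if i = k then Suc k else i) l"
    have l': "word (Suc (Suc k)) l'" "length l' = m" "Suc k \<in> set l'"
      using l by (auto simp: l'_def less_Suc_eq subset_iff)
    have l'_L: "map (subst (Suc k) [a]) l' = L a" for a
      using l by (auto simp: l'_def L_def subst_def less_Suc_eq subset_iff)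
    have line: "mono_line (Suc k) (m + n) \<chi>" if m_line: "mono_line (Suc k) n \<chi>'"
    proof -
      obtain p c where p: "word (Suc (Suc k)) p" "length p = n" "Suc k \<in> set p"
        "\<forall>a<Suc k. \<chi>' (map (subst (Suc k) [a]) p) = c"
        using m_line unfolding mono_line_def by blast
      show ?thesis
        unfolding mono_line_def
        using p L[of 0] by (intro exI[of _ "L 0 @ p"] exI[of _ c]) (auto simp: \<chi>'_def)
    qed
    have "mono_line (Suc k) n \<chi>' \<or> (\<exists>Cs\<subseteq>{..<r}. card Cs = j \<and> focused k n Cs \<chi>')"
      using L[of 0] by (intro n[rule_format]) (auto simp: \<chi>'_def intro!: \<chi>[rule_format])
    then show ?thesis
    proof
      assume "\<exists>Cs\<subseteq>{..<r}. card Cs = j \<and> focused k n Cs \<chi>'"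
      then obtain Cs f where Cs: "Cs \<subseteq> {..<r}" "card Cs = j" and f: "word (Suc k) f" "length f = n"
        and ex: "\<forall>c\<in>Cs. \<exists>p. word (Suc (Suc k)) p \<and> length p = n \<and> Suc k \<in> set p \<and>
          map (subst (Suc k) [k]) p = f \<and> (\<forall>a<k. \<chi>' (map (subst (Suc k) [a]) p) = c)"
        by (auto simp: focused_def)
      obtain p where p: "\<And>c. c \<in> Cs \<Longrightarrow> word (Suc (Suc k)) (p c) \<and> length (p c) = n \<and>
          Suc k \<in> set (p c) \<and> map (subst (Suc k) [k]) (p c) = f \<and>
          (\<forall>a<k. \<chi>' (map (subst (Suc k) [a]) (p c)) = c)"
        using bchoice[OF ex] by blast
      show ?thesis
      proof (cases "\<chi>' f \<in> Cs")
        case True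
        \<comment> \<open>The focused line of this colour has it at the last letter too, where it
          passes through \<open>f\<close>.\<close>
        have "\<chi>' (map (subst (Suc k) [a]) (p (\<chi>' f))) = \<chi>' f" if "a < Suc k" for a
          using p[OF True] that by (cases "a = k") auto
        then have "mono_line (Suc k) n \<chi>'"
          using p[OF True] unfolding mono_line_def by blast
        then show ?thesis using line by blast
      next
        case False
        have sub: "insert (\<chi>' f) Cs \<subseteq> {..<r}"
          using Cs f L[of 0] by (auto simp: \<chi>'_def intro!: \<chi>[rule_format])
        have "finite Cs" using Cs(1) finite_subset by blast
        then have card: "card (insert (\<chi>' f) Cs) = Suc j" using False Cs(2) by simp
        have new: "\<forall>a<k. \<chi> (map (subst (Suc k) [a]) (l' @ f)) = \<chi>' f"
          using f eq by (simp add: l'_L)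
        have old: "\<forall>a<k. \<chi> (map (subst (Suc k) [a]) (l' @ p c)) = c" if "c \<in> Cs" for c
        proof (intro allI impI)
          fix a assume "a < k"
          moreover have "word (Suc k) (map (subst (Suc k) [a]) (p c))"
            using p[OF that] \<open>a < k\<close> by (intro word_map_subst) auto
          ultimately show "\<chi> (map (subst (Suc k) [a]) (l' @ p c)) = c"
            using p[OF that] eq by (simp add: l'_L)
        qed
        have "focused k (m + n) (insert (\<chi>' f) Cs) \<chi>"
          unfolding focused_def
        proof (rule exI[of _ "L k @ f"], intro conjI ballI)
          fix c assume c: "c \<in> insert (\<chi>' f) Cs"
          define q where "q = (if c = \<chi>' f then f else p c)"
          have "word (Suc (Suc k)) q \<and> length q = n \<and> map (subst (Suc k) [k]) q = f"
          proof (cases "c = \<chi>' f")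
            case False
            with c have "c \<in> Cs" by simp
            from p[OF this] False show ?thesis by (simp add: q_def)
          qed (use f in \<open>auto simp: q_def\<close>)
          moreover have "\<forall>a<k. \<chi> (map (subst (Suc k) [a]) (l' @ q)) = c"
            using c new old by (auto simp: q_def)
          ultimately show "\<exists>l. word (Suc (Suc k)) l \<and> length l = m + n \<and> Suc k \<in> set l \<and>
              map (subst (Suc k) [k]) l = L k @ f \<and> (\<forall>a<k. \<chi> (map (subst (Suc k) [a]) l) = c)"
            using l' l'_L by (intro exI[of _ "l' @ q"]) auto
        qed (use L[of k] f in auto)
        then show ?thesis using sub card by blast
      qed
    qed (use line in blast)
  qed
  then show ?case by blast
qed

text \<open>Once all \<open>r\<close> colours are focused, the colour of the focus is among them,
  and the line belonging to it is monochromatic on every letter.\<close>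

theorem hales_jewett: "hales_jewett k r"
proof (induction k arbitrary: r)
  case 0
  show ?case
    by (auto simp: hales_jewett_def mono_line_def intro!: exI[of _ "[0]"])
next
  case (Suc k)
  from colour_focusing[OF Suc.IH order.refl] obtain n where n: "\<forall>\<chi>. (\<forall>w. word (Suc k) w \<and> length w = n \<longrightarrow> \<chi> w < r) \<longrightarrow>
      mono_line (Suc k) n \<chi> \<or> (\<exists>Cs\<subseteq>{..<r}. card Cs = r \<and> focused k n Cs \<chi>)"
    ..
  have "mono_line (Suc k) n \<chi>" if \<chi>: "\<forall>w. word (Suc k) w \<and> length w = n \<longrightarrow> \<chi> w < r" for \<chi>
  proof (rule ccontr)
    assume no: "\<not> mono_line (Suc k) n \<chi>"
    then obtain Cs where "Cs \<subseteq> {..<r}" "card Cs = r" and foc: "focused k n Cs \<chi>"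
      using n \<chi> by blast
    then have "Cs = {..<r}" by (simp add: card_subset_eq)
    then obtain f where f: "word (Suc k) f" "length f = n"
      and "\<forall>c<r. \<exists>l. word (Suc (Suc k)) l \<and> length l = n \<and> Suc k \<in> set l \<and>
        map (subst (Suc k) [k]) l = f \<and> (\<forall>a<k. \<chi> (map (subst (Suc k) [a]) l) = c)"
      using foc by (auto simp: focused_def)
    with \<chi>[rule_format, OF conjI[OF f]] obtain l where l: "word (Suc (Suc k)) l" "length l = n" "Suc k \<in> set l"
        "map (subst (Suc k) [k]) l = f" "\<And>a. a < k \<Longrightarrow> \<chi> (map (subst (Suc k) [a]) l) = \<chi> f"
      by blast
    then have "\<forall>a<Suc k. \<chi> (map (subst (Suc k) [a]) l) = \<chi> f"
      by (auto simp: less_Suc_eq)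
    with l no show False unfolding mono_line_def by blast
  qed
  then show ?case unfolding hales_jewett_def by blast
qed

text \<open>\<open>s @ k # t\<close> is the shape in which a parameter word gains its next
  parameter. The colour of \<open>s\<close> itself has to agree because substitution may also stop
  just before that parameter.\<close>

definition left_mono :: "nat \<Rightarrow> (nat list \<Rightarrow> 'c) \<Rightarrow> bool" where
  "left_mono k \<chi> \<longleftrightarrow> (\<exists>s t. word k s \<and> word (Suc k) t \<and>
     (\<forall>a<k. \<chi> (s @ a # map (subst k [a]) t) = \<chi> s))"

text \<open>Given a line \<open>p @ k # t\<close> along which the colour of all short extensions is constant, either
  the colour of \<open>p\<close> recurs on an extension, or the extensions use one colour fewer.\<close>

lemma left_hales_jewett_bounded:
  fixes C :: "'c set"
  assumes "k > 0" "finite C"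
  shows "\<exists>n. \<forall>\<chi>. (\<forall>w. word k w \<and> length w \<le> n \<longrightarrow> \<chi> w \<in> C) \<longrightarrow> left_mono k \<chi>"
  using \<open>finite C\<close>
proof (induction C rule: finite_psubset_induct)
  case (psubset C)
  have "\<forall>c\<in>C. \<exists>n. \<forall>\<chi>. (\<forall>w. word k w \<and> length w \<le> n \<longrightarrow> \<chi> w \<in> C - {c}) \<longrightarrow> left_mono k \<chi>"
    using psubset.IH by blast
  then obtain N where N: "\<forall>c\<in>C. \<forall>\<chi>. (\<forall>w. word k w \<and> length w \<le> N c \<longrightarrow> \<chi> w \<in> C - {c})
      \<longrightarrow> left_mono k \<chi>"
    using bchoice[of C "\<lambda>c n. \<forall>\<chi>. (\<forall>w. word k w \<and> length w \<le> n \<longrightarrow> \<chi> w \<in> C - {c}) \<longrightarrow> left_mono k \<chi>"]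
    by blast
  \<comment> \<open>An upper bound for all \<open>N c\<close>, so that the length does not depend on
    which colour drops out.\<close>
  define n where "n = sum N C"
  have N_le: "N c \<le> n" if "c \<in> C" for c
    unfolding n_def using psubset.hyps that by (simp add: member_le_sum)
  let ?X = "{x. word k x \<and> length x \<le> n}"
  have "finite (?X \<rightarrow>\<^sub>E C)"
    using psubset.hyps by (intro finite_PiE finite_words_le) auto
  from hales_jewett_any_colours[OF hales_jewett this] obtain m where m: "\<forall>\<chi>. (\<forall>w. word k w \<and> length w = m \<longrightarrow> \<chi> w \<in> ?X \<rightarrow>\<^sub>E C) \<longrightarrow>
      mono_line k m \<chi>"
    ..
  have "left_mono k \<chi>" if \<chi>: "\<forall>w. word k w \<and> length w \<le> m + n \<longrightarrow> \<chi> w \<in> C" for \<chi>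
  proof -
    have "mono_line k m (\<lambda>y. \<lambda>x\<in>?X. \<chi> (y @ x))"
      using \<chi> by (intro m[rule_format]) auto
    then obtain l g where l: "word (Suc k) l" "length l = m" "k \<in> set l"
      and g: "\<And>a. a < k \<Longrightarrow> (\<lambda>x\<in>?X. \<chi> (map (subst k [a]) l @ x)) = g"
      by (auto simp: mono_line_def)
    have eq: "\<chi> (map (subst k [a]) l @ x) = \<chi> (map (subst k [0]) l @ x)"
      if "a < k" "word k x" "length x \<le> n" for a x
    proof -
      have "(\<lambda>x\<in>?X. \<chi> (map (subst k [a]) l @ x)) = (\<lambda>x\<in>?X. \<chi> (map (subst k [0]) l @ x))"
        by (rule trans[OF g[OF \<open>a < k\<close>] g[OF \<open>k > 0\<close>, symmetric]])
      from fun_cong[OF this, of x] show ?thesis using that by simp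
    qed
    obtain p t where pt: "l = p @ k # t" "k \<notin> set p"
      using split_list_first[OF l(3)] by blast
    have p: "word k p" and t: "word (Suc k) t"
      using l(1) pt by (auto simp: less_Suc_eq subset_iff)
    have l0: "word k (map (subst k [0]) l)"
      using l \<open>k > 0\<close> by (intro word_map_subst) auto
    have pC: "\<chi> p \<in> C"
      using p l(2) pt by (intro \<chi>[rule_format]) auto
    show ?thesis
    proof (cases "\<exists>x. word k x \<and> length x \<le> n \<and> \<chi> (map (subst k [0]) l @ x) = \<chi> p")
      case True
      then obtain x where x: "word k x" "length x \<le> n" "\<chi> (map (subst k [0]) l @ x) = \<chi> p"
        by blast
      have "\<chi> (p @ a # map (subst k [a]) (t @ x)) = \<chi> p" if "a < k" for a
        using eq[OF that x(1,2)] x p pt subst_var[of k "[a]" 0] by simp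
      then show ?thesis
        using p t x(1) unfolding left_mono_def
        by (intro exI[of _ p] exI[of _ "t @ x"]) (auto simp: less_Suc_eq)
    next
      case False
      have "left_mono k (\<lambda>x. \<chi> (map (subst k [0]) l @ x))"
      proof (rule N[rule_format, OF pC])
        fix w assume w: "word k w \<and> length w \<le> N (\<chi> p)"
        then have "length w \<le> n" using N_le[OF pC] by simp
        then show "\<chi> (map (subst k [0]) l @ w) \<in> C - {\<chi> p}"
          using False w l0 l(2) \<chi>[rule_format, of "map (subst k [0]) l @ w"] by auto
      qed
      then obtain s u where "word k s" "word (Suc k) u"
        "\<And>a. a < k \<Longrightarrow> \<chi> (map (subst k [0]) l @ s @ a # map (subst k [a]) u) = \<chi> (map (subst k [0]) l @ s)"
        by (auto simp: left_mono_def)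
      then show ?thesis
        using l0 unfolding left_mono_def
        by (intro exI[of _ "map (subst k [0]) l @ s"] exI[of _ u]) simp
    qed
  qed
  then show ?case by blast
qed

lemma left_hales_jewett:
  assumes "k > 0" "finite C" "\<And>w. word k w \<Longrightarrow> \<chi> w \<in> C"
  obtains s t where "word k s" "word (Suc k) t" "\<And>a. a < k \<Longrightarrow> \<chi> (s @ a # map (subst k [a]) t) = \<chi> s"
  using left_hales_jewett_bounded[OF assms(1,2)] assms(3) unfolding left_mono_def by metis

section \<open>Infinite parameter words\<close>

text \<open>An infinite parameter word over the alphabet \<open>{..<k}\<close> is given by the prefixes \<open>P n\<close>
  preceding the first occurrence of its \<open>n\<close>-th parameter, which is encoded by the letter
  \<open>k + n\<close>. Substituting a word of length \<open>n\<close> also truncates at that occurrence.\<close>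

definition param_word :: "nat \<Rightarrow> (nat \<Rightarrow> nat list) \<Rightarrow> bool" where
  "param_word k P \<longleftrightarrow> word k (P 0) \<and> (\<forall>n. \<exists>t. word (Suc (k + n)) t \<and> P (Suc n) = P n @ (k + n) # t)"

definition app :: "nat \<Rightarrow> (nat \<Rightarrow> nat list) \<Rightarrow> nat list \<Rightarrow> nat list" where
  "app k P u = map (subst k u) (P (length u))"

definition img :: "nat \<Rightarrow> (nat \<Rightarrow> nat list) \<Rightarrow> nat list set" where
  "img k P = app k P ` {t. word k t}"

definition comp_pw :: "nat \<Rightarrow> (nat \<Rightarrow> nat list) \<Rightarrow> (nat \<Rightarrow> nat list) \<Rightarrow> nat \<Rightarrow> nat list" where
  "comp_pw k P Q n = app k P (Q n)"

text \<open>What follows the \<open>n\<close>-th parameter. There the letters up to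
  \<open>k + n\<close> count as constants, so this is a parameter word over
  \<open>Suc (k + n)\<close> letters.\<close>

definition tail :: "nat \<Rightarrow> (nat \<Rightarrow> nat list) \<Rightarrow> nat \<Rightarrow> nat list" where
  "tail n P m = drop (Suc (length (P n))) (P (Suc (n + m)))"

lemma param_word_word:
  assumes "param_word k P"
  shows "word (k + n) (P n)"
proof (induction n)
  case (Suc n)
  obtain t where "word (Suc (k + n)) t" "P (Suc n) = P n @ (k + n) # t"
    using assms unfolding param_word_def by blast
  with Suc show ?case by (auto simp: less_Suc_eq)
qed (use assms in \<open>auto simp: param_word_def\<close>)

lemma param_word_append:
  assumes "param_word k P"
  shows "P (Suc (n + m)) = P n @ (k + n) # tail n P m"
proof -
  have "\<exists>t. P (Suc (n + m)) = P n @ (k + n) # t"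
  proof (induction m)
    case 0
    show ?case using assms by (auto simp: param_word_def)
  next
    case (Suc m)
    obtain t where "P (Suc (n + Suc m)) = P (n + Suc m) @ (k + (n + Suc m)) # t"
      using assms unfolding param_word_def by blast
    with Suc show ?case by auto
  qed
  then show ?thesis by (auto simp: tail_def)
qed

lemma param_word_tail:
  assumes "param_word k P"
  shows "param_word (Suc (k + n)) (tail n P)"
  unfolding param_word_def
proof (intro conjI allI)
  show "word (Suc (k + n)) (tail n P 0)"
    using param_word_append[OF assms, of n 0] param_word_word[OF assms, of "Suc n"] by auto
next
  fix m
  obtain t where "word (Suc (k + Suc (n + m))) t"
    "P (Suc (Suc (n + m))) = P (Suc (n + m)) @ (k + Suc (n + m)) # t"
    using assms unfolding param_word_def by blast
  then show "\<exists>t. word (Suc (Suc (k + n) + m)) t \<and>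
      tail n P (Suc m) = tail n P m @ (Suc (k + n) + m) # t"
    using param_word_append[OF assms, of n m] param_word_append[OF assms, of n "Suc m"]
    by (intro exI[of _ t]) (auto simp: add.assoc)
qed

lemma param_word_upt: "param_word k (\<lambda>n. [k..<k + n])"
  by (auto simp: param_word_def)

lemma word_app:
  assumes "param_word k P" "word m u" "k \<le> m"
  shows "word m (app k P u)"
  unfolding app_def using param_word_word[OF assms(1)] assms(2,3) by (rule word_map_subst)

lemma img_word: "param_word k P \<Longrightarrow> x \<in> img k P \<Longrightarrow> word k x"
  unfolding img_def using word_app by blast

lemma subst_subst:
  "i < k + length u \<Longrightarrow> subst k v (subst k u i) = subst k (map (subst k v) u) i"
  by (auto simp: subst_def)

lemma map_subst_subst:
  "word (k + length u) w \<Longrightarrow> map (subst k v) (map (subst k u) w) = map (subst k (map (subst k v) u)) w"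
  by (auto simp: subst_subst)

lemma map_subst_app:
  assumes "param_word k P"
  shows "map (subst k v) (app k P u) = app k P (map (subst k v) u)"
  unfolding app_def using map_subst_subst[OF param_word_word[OF assms]] by simp

lemma app_append:
  assumes "param_word k P"
  shows "app k P (v @ a # t) = app k P v @ a # map (subst k (v @ a # t)) (tail (length v) P (length t))"
proof -
  have "map (subst k (v @ a # t)) (P (length v)) = map (subst k v) (P (length v))"
    using param_word_word[OF assms, of "length v"] by (auto simp: subst_def nth_append)
  then show ?thesis
    using param_word_append[OF assms, of "length v" "length t"] by (simp add: app_def)
qed

lemma app_comp_pw:
  "param_word k P \<Longrightarrow> app k (comp_pw k P Q) u = app k P (app k Q u)"
  by (simp add: app_def[of k "comp_pw k P Q"] comp_pw_def map_subst_app) (simp add: app_def)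

lemma param_word_comp:
  assumes P: "param_word k P" and Q: "param_word k Q"
  shows "param_word k (comp_pw k P Q)"
  unfolding param_word_def comp_pw_def
proof (intro conjI allI)
  show "word k (app k P (Q 0))"
    using P Q by (intro word_app) (auto simp: param_word_def)
next
  fix n
  obtain t where t: "Q (Suc n) = Q n @ (k + n) # t"
    using Q unfolding param_word_def by blast
  have "word (k + Suc n) (app k P (Q (Suc n)))"
    using P param_word_word[OF Q, of "Suc n"] by (intro word_app) auto
  then show "\<exists>t. word (Suc (k + n)) t \<and> app k P (Q (Suc n)) = app k P (Q n) @ (k + n) # t"
    unfolding t by (auto simp: app_append[OF P])
qed

lemma img_comp_pw:
  assumes "param_word k P" "param_word k Q"
  shows "img k (comp_pw k P Q) \<subseteq> img k P"
  using word_app[OF assms(2)] by (auto simp: img_def app_comp_pw[OF assms(1)])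

text \<open>Splits a substitution in two: \<open>t\<close> first instantiates the tail over the
  larger alphabet, possibly by earlier parameters, and \<open>v @ [a]\<close> then replaces these.
  This carries whatever is arranged for the tail over to \<open>P\<close>.\<close>

lemma app_tail:
  assumes "param_word k P" "length v = n"
  shows "app k P (v @ a # map (subst k (v @ [a])) t) =
    map (subst k (v @ [a])) (P n @ (k + n) # app (Suc (k + n)) (tail n P) t)"
proof -
  let ?\<sigma> = "subst k (v @ [a])"
  have "map (subst k v) (P n) = map ?\<sigma> (P n)"
    using param_word_word[OF assms(1), of n] assms(2) by (auto simp: subst_def nth_append)
  moreover have "?\<sigma> (k + n) = a"
    using assms(2) subst_var[of k "v @ [a]" n] by (simp add: nth_append)
  moreover have "map (subst k (v @ a # map ?\<sigma> t)) (tail n P (length t)) =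
      map ?\<sigma> (app (Suc (k + n)) (tail n P) t)"
    unfolding app_def map_map
  proof (rule map_cong[OF refl])
    fix i assume "i \<in> set (tail n P (length t))"
    then have "i < Suc (k + n) + length t"
      using param_word_word[OF param_word_tail[OF assms(1)]] by blast
    then show "subst k (v @ a # map ?\<sigma> t) i = (?\<sigma> \<circ> subst (Suc (k + n)) t) i"
      using assms(2) by (auto simp: subst_def nth_append nth_Cons' Suc_diff_Suc)
  qed
  ultimately show ?thesis
    using app_append[OF assms(1), of v a "map ?\<sigma> t"] assms(2) by (simp add: app_def)
qed

text \<open>Dependent choice. The state \<open>q\<close> is empty or ends with the latest parameter,
  and the invariant \<open>I\<close> concerns it; the requirement \<open>G\<close> is imposed on
  \<open>q @ t\<close>, the full prefix before the next parameter.\<close>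

lemma param_word_build:
  assumes "I 0 []"
    and step: "\<And>n q. I n q \<Longrightarrow> word (k + n) q \<Longrightarrow>
      \<exists>t. word (k + n) t \<and> G n (q @ t) \<and> I (Suc n) (q @ t @ [k + n])"
  obtains P where "param_word k P" "\<And>n. G n (P n)"
proof -
  have "\<exists>s. \<forall>n. (I n (s n) \<and> word (k + n) (s n)) \<and>
      (\<exists>t. word (k + n) t \<and> G n (s n @ t) \<and> s (Suc n) = s n @ t @ [k + n])"
  proof (rule dependent_nat_choice)
    show "\<exists>q. I 0 q \<and> word (k + 0) q"
      using assms(1) by (intro exI[of _ "[]"]) simp
  next
    fix q n assume q: "I n q \<and> word (k + n) q"
    then obtain t where t: "word (k + n) t" "G n (q @ t)" "I (Suc n) (q @ t @ [k + n])"
      using step[of n q] by blast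
    have "word (k + Suc n) (q @ t @ [k + n])" using q t(1) by auto
    then show "\<exists>y. (I (Suc n) y \<and> word (k + Suc n) y) \<and>
        (\<exists>t. word (k + n) t \<and> G n (q @ t) \<and> y = q @ t @ [k + n])"
      using t by blast
  qed
  then obtain s where w: "\<And>n. word (k + n) (s n)"
    and s: "\<And>n. \<exists>t. word (k + n) t \<and> G n (s n @ t) \<and> s (Suc n) = s n @ t @ [k + n]"
    by blast
  obtain T where T: "\<And>n. word (k + n) (T n)" "\<And>n. G n (s n @ T n)"
      "\<And>n. s (Suc n) = s n @ T n @ [k + n]"
    using s by metis
  have "param_word k (\<lambda>n. s n @ T n)"
    unfolding param_word_def
  proof (intro conjI allI)
    show "word k (s 0 @ T 0)" using w[of 0] T(1)[of 0] by simp
    show "\<exists>t. word (Suc (k + n)) t \<and> s (Suc n) @ T (Suc n) = (s n @ T n) @ (k + n) # t" for n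
      using T(1)[of "Suc n"] T(3)[of n] by auto
  qed
  with T(2) show thesis by (intro that)
qed

text \<open>The state is a fixed prefix together with a reservoir \<open>R\<close> of continuations.
  Each stage fixes the prefix up to the first parameter of \<open>R\<close> and thins the rest of
  \<open>R\<close> to satisfy \<open>\<Phi>\<close>. Later reservoirs only shrink, so the tail of
  the limit stays inside the thinned one and \<open>mono\<close> applies.\<close>

lemma fusion:
  assumes mono: "\<And>n p X Y. \<Phi> n p X \<Longrightarrow> Y \<subseteq> X \<Longrightarrow> \<Phi> n p Y"
    and dense: "\<And>n p Q. param_word (Suc (k + n)) Q \<Longrightarrow>
      \<exists>S. param_word (Suc (k + n)) S \<and> img (Suc (k + n)) S \<subseteq> img (Suc (k + n)) Q \<and>
        \<Phi> n p (img (Suc (k + n)) S)"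
  obtains P where "param_word k P" "\<And>n. \<Phi> n (P n) (img (Suc (k + n)) (tail n P))"
proof -
  define step where "step n x y \<longleftrightarrow>
    (case x of (q, R) \<Rightarrow> case y of (q', R') \<Rightarrow> q' = q @ R 0 @ [k + n] \<and>
      img (Suc (k + n)) R' \<subseteq> img (Suc (k + n)) (tail 0 R) \<and>
      \<Phi> n (q @ R 0) (img (Suc (k + n)) R'))"
    for n and x y :: "nat list \<times> (nat \<Rightarrow> nat list)"
  have "\<exists>f. \<forall>n. (word (k + n) (fst (f n)) \<and> param_word (k + n) (snd (f n))) \<and> step n (f n) (f (Suc n))"
  proof (rule dependent_nat_choice)
    show "\<exists>x. word (k + 0) (fst x) \<and> param_word (k + 0) (snd x)"
      using param_word_upt[of k] by (intro exI[of _ "([], \<lambda>n. [k..<k + n])"]) simp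
  next
    fix x :: "nat list \<times> (nat \<Rightarrow> nat list)" and n
    assume x: "word (k + n) (fst x) \<and> param_word (k + n) (snd x)"
    obtain q R where qR: "x = (q, R)" by fastforce
    have R: "param_word (k + n) R" using x qR by simp
    have "param_word (Suc (k + n)) (tail 0 R)"
      using param_word_tail[OF R, of 0] by simp
    from dense[OF this, of "q @ R 0"] obtain S where S: "param_word (Suc (k + n)) S"
      "img (Suc (k + n)) S \<subseteq> img (Suc (k + n)) (tail 0 R)"
      "\<Phi> n (q @ R 0) (img (Suc (k + n)) S)"
      by blast
    have "word (k + Suc n) (q @ R 0 @ [k + n])"
      using x qR param_word_word[OF R, of 0] by auto
    then show "\<exists>y. (word (k + Suc n) (fst y) \<and> param_word (k + Suc n) (snd y)) \<and> step n x y"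
      using S by (intro exI[of _ "(q @ R 0 @ [k + n], S)"]) (simp add: step_def qR)
  qed
  then obtain f where f: "\<And>n. word (k + n) (fst (f n))" "\<And>n. param_word (k + n) (snd (f n))"
    "\<And>n. step n (f n) (f (Suc n))"
    by blast
  define q R where "q n = fst (f n)" and "R n = snd (f n)" for n
  have q: "word (k + n) (q n)" and R: "param_word (k + n) (R n)" for n
    using f(1,2)[of n] by (simp_all add: q_def R_def)
  have q_Suc: "q (Suc n) = q n @ R n 0 @ [k + n]"
    and R_Suc: "img (Suc (k + n)) (R (Suc n)) \<subseteq> img (Suc (k + n)) (tail 0 (R n))"
    and \<Phi>: "\<Phi> n (q n @ R n 0) (img (Suc (k + n)) (R (Suc n)))" for n
    using f(3)[of n] by (simp_all add: step_def q_def R_def split_beta)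
  define P where "P n = q n @ R n 0" for n
  have R0: "word (k + n) (R n 0)" for n
    using param_word_word[OF R, of n 0] by simp
  have P: "param_word k P"
    unfolding param_word_def
  proof (intro conjI allI)
    show "word k (P 0)" using q[of 0] R0[of 0] by (simp add: P_def)
    show "\<exists>t. word (Suc (k + n)) t \<and> P (Suc n) = P n @ (k + n) # t" for n
      using R0[of "Suc n"] by (auto simp: P_def q_Suc)
  qed
  \<comment> \<open>Induction on the substituted word: its first letter fills the first parameter of
    the reservoir, and its rest is handled by the next reservoir, over one letter more.\<close>
  have tail_img: "app (Suc (k + n)) (tail n P) t \<in> img (Suc (k + n)) (R (Suc n))"
    if "word (Suc (k + n)) t" for n t
    using that
  proof (induction t arbitrary: n)
    case Nil
    have "tail n P 0 = R (Suc n) 0"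
      by (simp add: tail_def P_def q_Suc)
    then have "app (Suc (k + n)) (tail n P) [] = app (Suc (k + n)) (R (Suc n)) []"
      by (simp add: app_def)
    then show ?case by (auto simp: img_def)
  next
    case (Cons a t)
    let ?k = "Suc (k + n)"
    have R': "param_word ?k (R (Suc n))"
      using R[of "Suc n"] by simp
    have T: "param_word ?k (tail n P)"
      by (rule param_word_tail[OF P])
    have T0: "tail n P 0 = R (Suc n) 0"
      by (simp add: tail_def P_def q_Suc)
    have T_tail: "tail 0 (tail n P) = tail (Suc n) P"
    proof
      fix m
      have "P (Suc (n + Suc m)) = P n @ (k + n) # tail n P (Suc m)"
        by (rule param_word_append[OF P])
      moreover have "P (Suc (Suc n + m)) = P (Suc n) @ (k + Suc n) # tail (Suc n) P m"
        by (rule param_word_append[OF P])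
      moreover have "P (Suc (n + 0)) = P n @ (k + n) # tail n P 0"
        by (rule param_word_append[OF P])
      ultimately show "tail 0 (tail n P) m = tail (Suc n) P m"
        by (simp add: tail_def[of 0 "tail n P"])
    qed
    have t: "word ?k t" and a: "a < ?k" using Cons.prems by auto
    have "word (Suc (k + Suc n)) t" using t by auto
    from Cons.IH[OF this] R_Suc[of "Suc n"]
    have "app (Suc ?k) (tail (Suc n) P) t \<in> img (Suc ?k) (tail 0 (R (Suc n)))"
      by auto
    then obtain s where s: "word (Suc ?k) s"
      "app (Suc ?k) (tail (Suc n) P) t = app (Suc ?k) (tail 0 (R (Suc n))) s"
      by (auto simp: img_def)
    have "app ?k (tail n P) (a # t) = app ?k (tail n P) ([] @ a # map (subst ?k ([] @ [a])) t)"
      using t by simp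
    also have "\<dots> = map (subst ?k [a]) (R (Suc n) 0 @ ?k # app (Suc ?k) (tail 0 (R (Suc n))) s)"
      using app_tail[OF T, of "[]" 0 a t] by (simp add: T_tail s T0)
    also have "\<dots> = app ?k (R (Suc n)) ([] @ a # map (subst ?k ([] @ [a])) s)"
      using app_tail[OF R', of "[]" 0 a s] by simp
    also have "\<dots> \<in> img ?k (R (Suc n))"
      unfolding img_def using s(1) a by (intro imageI) (auto intro!: subst_bound)
    finally show ?case .
  qed
  have "\<Phi> n (P n) (img (Suc (k + n)) (tail n P))" for n
    by (rule mono[OF \<Phi>[of n, folded P_def]]) (auto simp: tail_img img_def[of _ "tail n P"])
  with P show thesis by (rule that)
qed

text \<open>Meet the requirements one at a time; those already met survive because they are
  hereditary.\<close>

lemma dense_finite: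
  assumes "finite I"
    and mono: "\<And>i X Y. i \<in> I \<Longrightarrow> \<Psi> i X \<Longrightarrow> Y \<subseteq> X \<Longrightarrow> \<Psi> i Y"
    and dense: "\<And>i Q. i \<in> I \<Longrightarrow> param_word k Q \<Longrightarrow>
      \<exists>S. param_word k S \<and> img k S \<subseteq> img k Q \<and> \<Psi> i (img k S)"
    and Q: "param_word k Q"
  shows "\<exists>S. param_word k S \<and> img k S \<subseteq> img k Q \<and> (\<forall>i\<in>I. \<Psi> i (img k S))"
  using assms(1-3)
proof (induction I rule: finite_induct)
  case empty
  then show ?case using Q by blast
next
  case (insert i I)
  have "\<exists>S. param_word k S \<and> img k S \<subseteq> img k Q \<and> (\<forall>i\<in>I. \<Psi> i (img k S))"
    by (rule insert.IH) (blast intro: insert.prems(1), blast intro: insert.prems(2))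
  then obtain S where S: "param_word k S" "img k S \<subseteq> img k Q" "\<forall>i\<in>I. \<Psi> i (img k S)"
    by blast
  obtain S' where S': "param_word k S'" "img k S' \<subseteq> img k S" "\<Psi> i (img k S')"
    using insert.prems(2)[of i S] S(1) by blast
  have "\<forall>j\<in>insert i I. \<Psi> j (img k S')"
    using S(3) S'(2,3) insert.prems(1) by blast
  then show ?case using S S' by blast
qed

section \<open>The Carlson--Simpson theorem\<close>

definition large :: "nat \<Rightarrow> nat list set \<Rightarrow> bool" where
  "large k D \<longleftrightarrow> (\<forall>S. param_word k S \<longrightarrow> img k S \<inter> D \<noteq> {})"

definition instances_in :: "nat \<Rightarrow> nat \<Rightarrow> nat list set \<Rightarrow> nat list \<Rightarrow> bool" where
  "instances_in k n C p \<longleftrightarrow> (\<forall>u. word k u \<and> length u = n \<longrightarrow> map (subst k u) p \<in> C)"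

text \<open>If the greedy construction of a parameter word avoiding \<open>D\<close> gets stuck, then every word has
  one of finitely many translates in \<open>D\<close>, and the left Hales--Jewett theorem applies to the
  choice of the translate.\<close>

lemma large_left_line:
  assumes "k > 0" "large k D"
  obtains s t where "word k s" "word (Suc k) t" "s \<in> D"
    "\<And>a. a < k \<Longrightarrow> s @ a # map (subst k [a]) t \<in> D"
proof -
  define U where "U n = {u. word k u \<and> length u = n}" for n
  have "\<exists>n q. word (k + n) q \<and> (\<forall>t. word (k + n) t \<longrightarrow> (\<exists>u\<in>U n. map (subst k u) (q @ t) \<in> D))"
  proof (rule ccontr)
    assume no: "\<not> ?thesis"
    have step: "\<exists>t. word (k + n) t \<and> (\<forall>u\<in>U n. map (subst k u) (q @ t) \<notin> D) \<and> True"
      if "word (k + n) q" for n q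
    proof (rule ccontr)
      assume "\<not> ?thesis"
      then have "\<forall>t. word (k + n) t \<longrightarrow> (\<exists>u\<in>U n. map (subst k u) (q @ t) \<in> D)"
        by blast
      with that have "\<exists>n q. word (k + n) q \<and>
          (\<forall>t. word (k + n) t \<longrightarrow> (\<exists>u\<in>U n. map (subst k u) (q @ t) \<in> D))"
        by (intro exI conjI)
      with no show False by (rule notE)
    qed
    obtain P where P: "param_word k P" "\<And>n. \<forall>u\<in>U n. map (subst k u) (P n) \<notin> D"
      by (rule param_word_build[of "\<lambda>_ _. True" k "\<lambda>n p. \<forall>u\<in>U n. map (subst k u) p \<notin> D",
        OF TrueI]) (rule step, assumption, rule that)
    then have "img k P \<inter> D = {}"
      by (auto simp: img_def app_def U_def)
    then show False using P assms(2) by (auto simp: large_def)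
  qed
  then obtain n q where q: "word (k + n) q"
    and ex: "\<And>t. word (k + n) t \<Longrightarrow> \<exists>u\<in>U n. map (subst k u) (q @ t) \<in> D"
    by blast
  define \<chi> where "\<chi> t = (SOME u. u \<in> U n \<and> map (subst k u) (q @ t) \<in> D)" for t
  have \<chi>: "\<chi> t \<in> U n" "map (subst k (\<chi> t)) (q @ t) \<in> D" if "word k t" for t
  proof -
    have "word (k + n) t" using that by auto
    then have "\<exists>u. u \<in> U n \<and> map (subst k u) (q @ t) \<in> D" using ex by blast
    from someI_ex[OF this] show "\<chi> t \<in> U n" "map (subst k (\<chi> t)) (q @ t) \<in> D"
      unfolding \<chi>_def by blast+
  qed
  have "finite (U n)"
    unfolding U_def by (rule finite_words)
  then obtain s t where s: "word k s" and t: "word (Suc k) t"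
    and mono: "\<And>a. a < k \<Longrightarrow> \<chi> (s @ a # map (subst k [a]) t) = \<chi> s"
    by (rule left_hales_jewett[OF assms(1) _ \<chi>(1)]) (assumption, rule that)
  \<comment> \<open>The chosen translate is the same along the whole line, its starting word
    \<open>s\<close> included, so this one prefix puts all of them into \<open>D\<close>.\<close>
  define p where "p = map (subst k (\<chi> s)) q"
  have "word k p"
    using q \<chi>(1)[OF s] unfolding p_def U_def by (intro word_map_subst) auto
  moreover have "p @ s \<in> D"
    using \<chi>(2)[OF s] s by (simp add: p_def)
  moreover have "p @ s @ a # map (subst k [a]) t \<in> D" if "a < k" for a
  proof -
    have w: "word k (map (subst k [a]) t)"
      using t that by (intro word_map_subst) auto
    then have w': "word k (s @ a # map (subst k [a]) t)"
      using s that by auto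
    show ?thesis
      using \<chi>(2)[OF w'] unfolding mono[OF that] map_append[of _ q] map_subst_word[OF w']
      by (simp add: p_def)
  qed
  ultimately show thesis
    using s t by (intro that[of "p @ s" t]) auto
qed

lemma subst_image:
  assumes "k \<le> m" "word m u" "{k..<m} \<subseteq> set u"
  shows "subst k u ` {..<k + length u} = {..<m}"
proof
  show "subst k u ` {..<k + length u} \<subseteq> {..<m}"
    using subst_bound assms by blast
  show "{..<m} \<subseteq> subst k u ` {..<k + length u}"
  proof
    fix i assume i: "i \<in> {..<m}"
    show "i \<in> subst k u ` {..<k + length u}"
    proof (cases "i < k")
      case False
      then have "i \<in> set u" using i assms(3) by auto
      then obtain j where "j < length u" "u ! j = i" by (auto simp: in_set_conv_nth)
      then show ?thesis by (intro image_eqI[of _ _ "k + j"]) auto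
    qed (auto intro!: image_eqI[of _ _ i])
  qed
qed

lemma word_preimage:
  assumes "\<sigma> ` {..<m} = {..<K}" "word K t"
  obtains s where "word m s" "map \<sigma> s = t"
proof -
  have "t \<in> lists (\<sigma> ` {..<m})" using assms by auto
  then show thesis using that by (auto simp: lists_image in_lists_conv_set)
qed

text \<open>Choose a section of \<open>\<sigma>\<close> on the letters and renumber the parameters.
  Largeness over the smaller alphabet can then be tested by parameter words over the larger
  one.\<close>

lemma param_word_lift:
  assumes \<sigma>: "\<sigma> ` {..<m} = {..<K}" and S: "param_word K S"
  obtains S' where "param_word m S'"
    "\<And>t. word m t \<Longrightarrow> map \<sigma> (app m S' t) = app K S (map \<sigma> t)"
proof -
  define \<rho> where "\<rho> i = (if i < K then inv_into {..<m} \<sigma> i else m + (i - K))" for i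
  have \<rho>: "\<rho> i < m \<and> \<sigma> (\<rho> i) = i" if "i < K" for i
  proof -
    have "i \<in> \<sigma> ` {..<m}" using that \<sigma> by simp
    then show ?thesis
      using that f_inv_into_f[of i \<sigma> "{..<m}"] inv_into_into[of i \<sigma> "{..<m}"] by (simp add: \<rho>_def)
  qed
  have \<rho>_word: "word (m + n) (map \<rho> w)" if "word (K + n) w" for n w
  proof -
    have "\<rho> i < m + n" if "i < K + n" for i
      using \<rho>[of i] that by (cases "i < K") (auto simp: \<rho>_def)
    with that show ?thesis by auto
  qed
  have "param_word m (\<lambda>n. map \<rho> (S n))"
    unfolding param_word_def
  proof (intro conjI allI)
    show "word m (map \<rho> (S 0))"
      using \<rho>_word[where n = 0] param_word_word[OF S, of 0] by simp
    fix n
    obtain t where "word (Suc (K + n)) t" "S (Suc n) = S n @ (K + n) # t"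
      using S unfolding param_word_def by blast
    moreover have "\<rho> (K + n) = m + n" by (simp add: \<rho>_def)
    ultimately show "\<exists>t. word (Suc (m + n)) t \<and> map \<rho> (S (Suc n)) = map \<rho> (S n) @ (m + n) # t"
      using \<rho>_word[of t "Suc n"] by auto
  qed
  moreover have "map \<sigma> (app m (\<lambda>n. map \<rho> (S n)) t) = app K S (map \<sigma> t)" for t
    unfolding app_def map_map length_map
  proof (rule map_cong[OF refl])
    fix i assume "i \<in> set (S (length t))"
    then have i: "i < K + length t" using param_word_word[OF S] by blast
    show "(\<sigma> \<circ> (subst m t \<circ> \<rho>)) i = subst K (map \<sigma> t) i"
    proof (cases "i < K")
      case True
      then show ?thesis using \<rho>[OF True] by simp
    next
      case False
      then show ?thesis using i by (auto simp: \<rho>_def subst_def)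
    qed
  qed
  ultimately show thesis by (rule that)
qed

lemma instances_in_app:
  "param_word k P \<Longrightarrow> instances_in k n {w. app k P w \<in> C} p \<longleftrightarrow> instances_in k n C (app k P p)"
  by (simp add: instances_in_def map_subst_app)

text \<open>The condition \<open>{k..<k + j} \<subseteq> set v\<close> makes every letter available as the value of
  some parameter of \<open>v @ [k + j]\<close>.\<close>

lemma decided:
  obtains P where "param_word k P"
    "\<And>j v D. word (k + j) v \<Longrightarrow> {k..<k + j} \<subseteq> set v \<Longrightarrow>
      D = {t. word (Suc (k + j)) t \<and> instances_in k (Suc j) {w. app k P w \<in> C} (v @ (k + j) # t)} \<Longrightarrow>
      D = {} \<or> large (Suc (k + j)) D"
proof -
  \<comment> \<open>The continuations \<open>x\<close> after the \<open>n\<close>-th parameter for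
    which, once \<open>v\<close> and \<open>k + j\<close> have replaced the parameters up to that
    one, all instances lie in \<open>C\<close>.\<close>
  define E where "E n p i = (case i of (j, v) \<Rightarrow>
      {x. instances_in k (Suc j) C (map (subst k (v @ [k + j])) (p @ (k + n) # x))})"
    for n p and i :: "nat \<times> nat list"
  \<comment> \<open>Hereditary by its form, and dense: a \<open>Q\<close> whose image lacks the
    second alternative contains an \<open>S\<close> with the first.\<close>
  define \<Psi> where "\<Psi> n p i X \<longleftrightarrow> X \<inter> E n p i = {} \<or>
      (\<forall>S. param_word (Suc (k + n)) S \<and> img (Suc (k + n)) S \<subseteq> X \<longrightarrow> img (Suc (k + n)) S \<inter> E n p i \<noteq> {})"
    for n p i X
  \<comment> \<open>\<open>v\<close> contains the \<open>j\<close> letters of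
    \<open>{k..<k + j}\<close>, hence \<open>j \<le> length v\<close>, and each stage has only
    finitely many requirements.\<close>
  define I where "I n = {..n} \<times> {v. word (k + n) v \<and> length v = n}" for n
  have fin: "finite (I n)" for n
    unfolding I_def by (intro finite_cartesian_product finite_words) simp
  obtain P where P: "param_word k P"
    and \<Psi>: "\<And>n. \<forall>i\<in>I n. \<Psi> n (P n) i (img (Suc (k + n)) (tail n P))"
  proof (rule fusion[of "\<lambda>n p X. \<forall>i\<in>I n. \<Psi> n p i X" k])
    show "\<forall>i\<in>I n. \<Psi> n p i Y" if "\<forall>i\<in>I n. \<Psi> n p i X" "Y \<subseteq> X" for n p X Y
      using that unfolding \<Psi>_def by blast
    show "\<exists>S. param_word (Suc (k + n)) S \<and> img (Suc (k + n)) S \<subseteq> img (Suc (k + n)) Q \<and>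
        (\<forall>i\<in>I n. \<Psi> n p i (img (Suc (k + n)) S))"
      if "param_word (Suc (k + n)) Q" for n p Q
    proof (rule dense_finite[OF fin _ _ that])
      show "\<Psi> n p i Y" if "\<Psi> n p i X" "Y \<subseteq> X" for i X Y
        using that unfolding \<Psi>_def by blast
      show "\<exists>S. param_word (Suc (k + n)) S \<and> img (Suc (k + n)) S \<subseteq> img (Suc (k + n)) Q \<and>
          \<Psi> n p i (img (Suc (k + n)) S)" if "param_word (Suc (k + n)) Q" for i Q
        using that unfolding \<Psi>_def by blast
    qed
  qed (rule that)
  have "D = {} \<or> large (Suc (k + j)) D"
    if v: "word (k + j) v" "{k..<k + j} \<subseteq> set v"
      and D: "D = {t. word (Suc (k + j)) t \<and>
        instances_in k (Suc j) {w. app k P w \<in> C} (v @ (k + j) # t)}"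
    for j v D
  proof -
    define n where "n = length v"
    define \<sigma> where "\<sigma> = subst k (v @ [k + j])"
    let ?M = "Suc (k + n)" and ?K = "Suc (k + j)"
    have "card {k..<k + j} \<le> card (set v)"
      using v(2) by (intro card_mono) auto
    then have "j \<le> n" using card_length[of v] by (simp add: n_def)
    then have jv: "(j, v) \<in> I n"
      using v(1) by (auto simp: I_def n_def)
    have "subst k (v @ [k + j]) ` {..<k + length (v @ [k + j])} = {..<?K}"
      using v by (intro subst_image) (auto simp: less_Suc_eq)
    then have \<sigma>: "\<sigma> ` {..<?M} = {..<?K}"
      by (simp add: \<sigma>_def n_def)
    have D_iff: "map \<sigma> s \<in> D \<longleftrightarrow> app ?M (tail n P) s \<in> E n (P n) (j, v)" if "word ?M s" for s
    proof -
      have "map \<sigma> s \<in> D \<longleftrightarrow> instances_in k (Suc j) C (app k P (v @ (k + j) # map \<sigma> s))"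
        using \<sigma> that unfolding D instances_in_app[OF P] by auto
      also have "app k P (v @ (k + j) # map \<sigma> s) = map \<sigma> (P n @ (k + n) # app ?M (tail n P) s)"
        unfolding \<sigma>_def by (rule app_tail[OF P]) (simp add: n_def)
      finally show ?thesis by (simp add: E_def \<sigma>_def)
    qed
    have T: "param_word ?M (tail n P)" by (rule param_word_tail[OF P])
    from \<Psi> jv consider (empty) "img ?M (tail n P) \<inter> E n (P n) (j, v) = {}"
      | (dense) "\<And>S. param_word ?M S \<Longrightarrow> img ?M S \<subseteq> img ?M (tail n P) \<Longrightarrow>
          img ?M S \<inter> E n (P n) (j, v) \<noteq> {}"
      unfolding \<Psi>_def by metis
    then show ?thesis
    proof cases
      case empty
      have "t \<notin> D" if t: "word ?K t" for t
      proof -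
        obtain s where "word ?M s" "map \<sigma> s = t" using word_preimage[OF \<sigma> t] .
        then show ?thesis using D_iff[of s] empty by (auto simp: img_def)
      qed
      then show ?thesis using D by blast
    next
      case dense
      have "img ?K S \<inter> D \<noteq> {}" if S: "param_word ?K S" for S
      proof -
        obtain S' where S': "param_word ?M S'"
          and eq: "\<And>t. word ?M t \<Longrightarrow> map \<sigma> (app ?M S' t) = app ?K S (map \<sigma> t)"
          using param_word_lift[OF \<sigma> S] by blast
        have "img ?M (comp_pw ?M (tail n P) S') \<inter> E n (P n) (j, v) \<noteq> {}"
          by (intro dense param_word_comp img_comp_pw T S')
        then obtain t where t: "word ?M t"
          "app ?M (tail n P) (app ?M S' t) \<in> E n (P n) (j, v)"
          by (auto simp: img_def app_comp_pw[OF T])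
        have "app ?K S (map \<sigma> t) \<in> D"
          using D_iff[of "app ?M S' t"] t word_app[OF S' t(1)] eq by simp
        moreover have "word ?K (map \<sigma> t)" using t(1) \<sigma> by auto
        ultimately show ?thesis unfolding img_def by blast
      qed
      then show ?thesis unfolding large_def by blast
    qed
  qed
  with P show thesis by (rule that)
qed

text \<open>If the pulled-back class \<open>C'\<close> is not large, some parameter word avoids it.
  Otherwise \<open>S\<close> is built so that the set \<open>D n q\<close> of good continuations
  stays large: \<open>large_left_line\<close> finds a good \<open>s\<close> together with a line,
  the line shows that the set after the next parameter is nonempty, and \<open>decided\<close>
  promotes nonempty to large. The condition on \<open>set q\<close> in the invariant is what
  \<open>decided\<close> asks for.\<close>

lemma carlson_simpson_two_colours:
  assumes "k > 0"
  obtains P where "param_word k P" "img k P \<subseteq> C \<or> img k P \<inter> C = {}"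
proof -
  obtain P where P: "param_word k P"
    and dec: "\<And>j v D. word (k + j) v \<Longrightarrow> {k..<k + j} \<subseteq> set v \<Longrightarrow>
      D = {t. word (Suc (k + j)) t \<and> instances_in k (Suc j) {w. app k P w \<in> C} (v @ (k + j) # t)} \<Longrightarrow>
      D = {} \<or> large (Suc (k + j)) D"
    using decided[of k C] by blast
  define C' where "C' = {w. app k P w \<in> C}"
  have img: "img k (comp_pw k P S) = app k P ` img k S" for S
    by (auto simp: img_def app_comp_pw[OF P])
  show thesis
  proof (cases "large k C'")
    case False
    then obtain S where "param_word k S" "img k S \<inter> C' = {}"
      by (auto simp: large_def)
    then show thesis
      using that[OF param_word_comp[OF P]] unfolding img C'_def by blast
  next
    case True
    define D where "D n q = {t. word (k + n) t \<and> instances_in k n C' (q @ t)}" for n q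
    obtain S where S: "param_word k S" "\<And>n. instances_in k n C' (S n)"
    proof (rule param_word_build[of "\<lambda>n q. large (k + n) (D n q) \<and> {k..<k + n} \<subseteq> set q" k
          "\<lambda>n. instances_in k n C'"])
      have "img k S \<inter> D 0 [] = img k S \<inter> C'" if "param_word k S" for S
        using img_word[OF that] by (auto simp: D_def instances_in_def)
      with True show "large (k + 0) (D 0 []) \<and> {k..<k + 0} \<subseteq> set []"
        by (simp add: large_def)
    next
      fix n q
      assume q: "large (k + n) (D n q) \<and> {k..<k + n} \<subseteq> set q" "word (k + n) q"
      have "k + n > 0" using assms by simp
      then obtain s t where s: "word (k + n) s" "s \<in> D n q" and t: "word (Suc (k + n)) t"
        and line: "\<And>a. a < k + n \<Longrightarrow> s @ a # map (subst (k + n) [a]) t \<in> D n q"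
        using large_left_line[of "k + n" "D n q"] q(1) by metis
      let ?D = "{t. word (Suc (k + n)) t \<and> instances_in k (Suc n) C' ((q @ s) @ (k + n) # t)}"
      have "instances_in k (Suc n) C' ((q @ s) @ (k + n) # t)"
        unfolding instances_in_def
      proof (intro allI impI)
        fix u assume u: "word k u \<and> length u = Suc n"
        then obtain u' a where u': "u = u' @ [a]" by (metis length_Suc_conv_rev)
        then have a: "a < k" "length u' = n" "word k u'" using u by auto
        have "map (subst k u) w = map (subst k u') w" if "word (k + n) w" for w
          using that a(2) by (auto simp: u' subst_def nth_append)
        note this[OF q(2)] this[OF s(1)]
        moreover have "map (subst k u) t = map (subst k u') (map (subst (k + n) [a]) t)"
          using t a by (auto simp: u' subst_def nth_append less_Suc_eq)
        moreover have "subst k u (k + n) = a"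
          using a(2) by (simp add: u' nth_append)
        ultimately have "map (subst k u) ((q @ s) @ (k + n) # t) =
            map (subst k u') (q @ s @ a # map (subst (k + n) [a]) t)"
          using a(1) by (simp del: map_map)
        moreover have "map (subst k u') (q @ s @ a # map (subst (k + n) [a]) t) \<in> C'"
          using line[of a] a unfolding D_def instances_in_def by fastforce
        ultimately show "map (subst k u) ((q @ s) @ (k + n) # t) \<in> C'"
          by (simp only:)
      qed
      then have "?D \<noteq> {}" using t by blast
      then have "large (Suc (k + n)) ?D"
        using dec[where j = n and v = "q @ s" and D = ?D] q s(1) unfolding C'_def by auto
      moreover have "?D = D (Suc n) (q @ s @ [k + n])"
        by (simp add: D_def)
      moreover have "{k..<k + Suc n} \<subseteq> set (q @ s @ [k + n])"
        using q(1) by (auto simp: less_Suc_eq)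
      ultimately show "\<exists>t. word (k + n) t \<and> instances_in k n C' (q @ t) \<and>
          large (k + Suc n) (D (Suc n) (q @ t @ [k + n])) \<and> {k..<k + Suc n} \<subseteq> set (q @ t @ [k + n])"
        using s by (intro exI[of _ s]) (simp add: D_def)
    qed (rule that)
    then have "img k S \<subseteq> C'"
      by (auto simp: img_def app_def instances_in_def)
    then show thesis
      using that[OF param_word_comp[OF P S(1)]] unfolding img C'_def by blast
  qed
qed

text \<open>Colours are removed one at a time: a class fills the image of a parameter word or is
  avoided by it, and then the argument continues inside that image.\<close>

lemma carlson_simpson_words:
  fixes F :: "'c set"
  assumes "k > 0" "finite F" "\<And>w. word k w \<Longrightarrow> \<chi> w \<in> F"
  shows "\<exists>P c. param_word k P \<and> (\<forall>w. word k w \<longrightarrow> \<chi> (app k P w) = c)"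
  using assms(2,3)
proof (induction F arbitrary: \<chi> rule: finite_induct)
  case empty
  then show ?case by (metis empty_iff empty_set empty_subsetI)
next
  case (insert c F)
  obtain P where P: "param_word k P" "img k P \<subseteq> {w. \<chi> w = c} \<or> img k P \<inter> {w. \<chi> w = c} = {}"
    using carlson_simpson_two_colours[OF assms(1)] .
  show ?case
  proof (cases "img k P \<subseteq> {w. \<chi> w = c}")
    case True
    then show ?thesis using P(1) by (intro exI[of _ P] exI[of _ c]) (auto simp: img_def)
  next
    case False
    have "\<chi> (app k P w) \<in> F" if "word k w" for w
      using insert.prems[OF word_app[OF P(1) that order.refl]] P(2) False that
      by (auto simp: img_def)
    then obtain Q c' where Q: "param_word k Q" "\<forall>w. word k w \<longrightarrow> \<chi> (app k P (app k Q w)) = c'"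
      using insert.IH[of "\<chi> \<circ> app k P"] by auto
    then show ?thesis
      using param_word_comp[OF P(1) Q(1)] by (intro exI[of _ "comp_pw k P Q"]) (auto simp: app_comp_pw[OF P(1)])
  qed
qed

text \<open>The shape of a prefix \<open>P d\<close> of an infinite parameter word. Dimension
  \<open>0\<close> gives plain words, the base case of \<open>carlson_simpson\<close>.\<close>

fun finite_param_word :: "nat \<Rightarrow> nat \<Rightarrow> nat list \<Rightarrow> bool" where
  "finite_param_word k 0 w \<longleftrightarrow> word k w"
| "finite_param_word k (Suc d) w \<longleftrightarrow>
    (\<exists>v t. finite_param_word k d v \<and> word (Suc (k + d)) t \<and> w = v @ (k + d) # t)"

lemma finite_param_word_set:
  "finite_param_word k d w \<Longrightarrow> word (k + d) w \<and> {k..<k + d} \<subseteq> set w"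
proof (induction d arbitrary: w)
  case (Suc d)
  then obtain v t where "finite_param_word k d v" "word (Suc (k + d)) t" "w = v @ (k + d) # t"
    by auto
  with Suc.IH[of v] show ?case by (auto simp: less_Suc_eq subset_iff)
qed auto

lemma finite_param_word_append:
  "finite_param_word k d w \<Longrightarrow> word (k + d) t \<Longrightarrow> finite_param_word k d (w @ t)"
  by (cases d) auto

lemma finite_param_word_app:
  assumes "param_word k P"
  shows "finite_param_word k d w \<Longrightarrow> finite_param_word k d (app k P w)"
proof (induction d arbitrary: w)
  case 0
  then show ?case using word_app[OF assms] by simp
next
  case (Suc d)
  then obtain v t where v: "finite_param_word k d v" "w = v @ (k + d) # t" by auto
  have "word (Suc (k + d)) (app k P w)"
    using word_app[OF assms, where m = "Suc (k + d)"] finite_param_word_set[OF Suc.prems] by simp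
  with Suc.IH[OF v(1)] show ?case
    unfolding v(2) app_append[OF assms] finite_param_word.simps by auto
qed

text \<open>Induction on the dimension. Fusion, with \<open>carlson_simpson_words\<close> over
  growing alphabets as the density step, makes the colour of \<open>V @ (k + d) # t\<close>
  independent of \<open>t\<close>. What remains is a colouring of the \<open>d\<close>-dimensional
  words \<open>V\<close>.\<close>

theorem carlson_simpson:
  fixes F :: "'c set"
  assumes "k > 0" "finite F" "\<And>w. \<chi> w \<in> F"
  shows "\<exists>P c. param_word k P \<and> (\<forall>w. finite_param_word k d w \<longrightarrow> \<chi> (app k P w) = c)"
  using assms(3)
proof (induction d arbitrary: \<chi>)
  case 0
  then show ?case using carlson_simpson_words[OF assms(1,2), of \<chi>] by simp
next
  case (Suc d)
  define \<Psi> where "\<Psi> n p V X \<longleftrightarrow>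
      (\<exists>c. \<forall>x\<in>X. \<chi> (map (subst k (V @ [k + d])) (p @ (k + n) # x)) = c)" for n p V and X :: "nat list set"
  define I where "I n = {V. finite_param_word k d V \<and> length V = n}" for n
  have fin: "finite (I n)" for n
    by (rule finite_subset[OF _ finite_words[of "k + d" n]])
      (use finite_param_word_set in \<open>auto simp: I_def\<close>)
  obtain P where P: "param_word k P"
    and \<Psi>: "\<And>n. \<forall>V\<in>I n. \<Psi> n (P n) V (img (Suc (k + n)) (tail n P))"
  proof (rule fusion[of "\<lambda>n p X. \<forall>V\<in>I n. \<Psi> n p V X" k])
    show "\<forall>V\<in>I n. \<Psi> n p V Y" if "\<forall>V\<in>I n. \<Psi> n p V X" "Y \<subseteq> X" for n p X Y
      using that unfolding \<Psi>_def by blast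
    show "\<exists>S. param_word (Suc (k + n)) S \<and> img (Suc (k + n)) S \<subseteq> img (Suc (k + n)) Q \<and>
        (\<forall>V\<in>I n. \<Psi> n p V (img (Suc (k + n)) S))"
      if "param_word (Suc (k + n)) Q" for n p Q
    proof (rule dense_finite[OF fin _ _ that])
      show "\<Psi> n p V Y" if "\<Psi> n p V X" "Y \<subseteq> X" for V X Y
        using that unfolding \<Psi>_def by blast
      show "\<exists>S. param_word (Suc (k + n)) S \<and> img (Suc (k + n)) S \<subseteq> img (Suc (k + n)) Q \<and>
          \<Psi> n p V (img (Suc (k + n)) S)" if Q: "param_word (Suc (k + n)) Q" for V Q
      proof -
        let ?M = "Suc (k + n)"
        obtain S c where S: "param_word ?M S"
          and c: "\<forall>t. word ?M t \<longrightarrow>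
            \<chi> (map (subst k (V @ [k + d])) (p @ (k + n) # app ?M Q (app ?M S t))) = c"
          using carlson_simpson_words[of ?M F
              "\<lambda>t. \<chi> (map (subst k (V @ [k + d])) (p @ (k + n) # app ?M Q t))"] assms(2) Suc.prems
          by auto
        have "\<Psi> n p V (img ?M (comp_pw ?M Q S))"
          unfolding \<Psi>_def using c by (intro exI[of _ c]) (auto simp: img_def app_comp_pw[OF Q])
        then show ?thesis
          using param_word_comp[OF Q S] img_comp_pw[OF Q S] by blast
      qed
    qed
  qed (rule that)
  have dep: "\<chi> (app k P (V @ (k + d) # t)) = \<chi> (app k P (V @ [k + d]))"
    if V: "finite_param_word k d V" and t: "word (Suc (k + d)) t" for V t
  proof -
    define n where "n = length V"
    define \<sigma> where "\<sigma> = subst k (V @ [k + d])"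
    let ?M = "Suc (k + n)"
    have "subst k (V @ [k + d]) ` {..<k + length (V @ [k + d])} = {..<Suc (k + d)}"
      using finite_param_word_set[OF V] by (intro subst_image) (auto simp: less_Suc_eq)
    then have \<sigma>: "\<sigma> ` {..<?M} = {..<Suc (k + d)}"
      by (simp add: \<sigma>_def n_def)
    have "\<Psi> n (P n) V (img ?M (tail n P))"
      using \<Psi> V by (auto simp: I_def n_def)
    then obtain c where c: "\<And>x. x \<in> img ?M (tail n P) \<Longrightarrow> \<chi> (map \<sigma> (P n @ (k + n) # x)) = c"
      unfolding \<Psi>_def \<sigma>_def by blast
    have *: "\<chi> (app k P (V @ (k + d) # map \<sigma> s)) = c" if "word ?M s" for s
      using c[of "app ?M (tail n P) s"] that app_tail[OF P, of V n "k + d" s]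
      by (simp add: \<sigma>_def n_def img_def)
    obtain s where "word ?M s" "map \<sigma> s = t"
      using word_preimage[OF \<sigma> t] .
    \<comment> \<open>The empty continuation serves as the reference value for every
      \<open>t\<close>.\<close>
    then show ?thesis using *[of s] *[of "[]"] by simp
  qed
  obtain Q c where Q: "param_word k Q"
    and c: "\<forall>w. finite_param_word k d w \<longrightarrow> \<chi> (app k P (app k Q w @ [k + d])) = c"
    using Suc.IH[of "\<lambda>w. \<chi> (app k P (w @ [k + d]))"] Suc.prems by auto
  have "\<chi> (app k (comp_pw k P Q) w) = c" if w: "finite_param_word k (Suc d) w" for w
  proof -
    obtain v t where v: "finite_param_word k d v" "w = v @ (k + d) # t"
      using w by auto
    have "word (Suc (k + d)) (app k Q w)"
      using word_app[OF Q, where m = "Suc (k + d)"] finite_param_word_set[OF w] by simp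
    moreover obtain t' where t': "app k Q w = app k Q v @ (k + d) # t'"
      unfolding v(2) app_append[OF Q] by blast
    ultimately have "word (Suc (k + d)) t'" by simp
    then show ?thesis
      using dep[OF finite_param_word_app[OF Q v(1)]] c v(1) t' by (simp add: app_comp_pw[OF P])
  qed
  then show ?case
    using param_word_comp[OF P Q] by blast
qed

text \<open>Passing to a further parameter word keeps the colourings already treated constant, since
  substitution preserves finite parameter words of each dimension.\<close>

lemma carlson_simpson_family:
  fixes \<chi> :: "'i \<Rightarrow> nat list \<Rightarrow> 'c"
  assumes "k > 0" "finite F" "finite I" "\<And>i w. i \<in> I \<Longrightarrow> \<chi> i w \<in> F"
  shows "\<exists>P. param_word k P \<and>
    (\<forall>i\<in>I. \<exists>c. \<forall>w. finite_param_word k (d i) w \<longrightarrow> \<chi> i (app k P w) = c)"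
  using assms(3,4)
proof (induction I rule: finite_induct)
  case empty
  then show ?case using param_word_upt by blast
next
  case (insert i I)
  then obtain P where P: "param_word k P"
    and c: "\<forall>i\<in>I. \<exists>c. \<forall>w. finite_param_word k (d i) w \<longrightarrow> \<chi> i (app k P w) = c"
    by auto
  obtain Q b where Q: "param_word k Q"
    and b: "\<forall>w. finite_param_word k (d i) w \<longrightarrow> \<chi> i (app k P (app k Q w)) = b"
    using carlson_simpson[OF assms(1,2), of "\<lambda>w. \<chi> i (app k P w)" "d i"] insert.prems by auto
  have "\<exists>c. \<forall>w. finite_param_word k (d j) w \<longrightarrow> \<chi> j (app k (comp_pw k P Q) w) = c"
    if "j \<in> insert i I" for j
  proof (cases "j = i")
    case True
    then show ?thesis using b by (auto simp: app_comp_pw[OF P])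
  next
    case False
    then have "j \<in> I" using that by simp
    with c finite_param_word_app[OF Q] show ?thesis by (fastforce simp: app_comp_pw[OF P])
  qed
  then show ?case using param_word_comp[OF P Q] by blast
qed

text \<open>Finite counterpart of \<open>app\<close>: the cut comes before the first parameter that
  receives no value, so one word \<open>U\<close> has instances of different lengths.\<close>

definition finite_app :: "nat \<Rightarrow> nat list \<Rightarrow> nat list \<Rightarrow> nat list" where
  "finite_app k U u = map (subst k u) (takeWhile (\<lambda>i. i < k + length u) U)"

lemma finite_param_word_prefix:
  "finite_param_word k d U \<Longrightarrow> m < d \<Longrightarrow> \<exists>V t. finite_param_word k m V \<and> U = V @ (k + m) # t"
proof (induction d arbitrary: U)
  case (Suc d)
  then obtain v t where v: "finite_param_word k d v" "U = v @ (k + d) # t" by auto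
  show ?case
  proof (cases "m = d")
    case False
    then obtain V s where "finite_param_word k m V" "v = V @ (k + m) # s"
      using Suc.IH[OF v(1)] Suc.prems(2) by auto
    then show ?thesis using v(2) by auto
  qed (use v in auto)
qed simp

lemma takeWhile_word: "word k w \<Longrightarrow> takeWhile (\<lambda>i. i < k) (w @ k # t) = w"
  by (subst takeWhile_append2) auto

text \<open>Both truncations happen at the same parameter. Thus a self-embedding by substitution
  changes the envelope of a tuple but not the data substituted into it.\<close>

lemma app_finite_app:
  assumes P: "param_word k P" and U: "finite_param_word k d U" and u: "length u \<le> d"
  shows "app k P (finite_app k U u) = finite_app k (app k P U) u"
proof (cases "length u = d")
  case True
  have "takeWhile (\<lambda>i. i < k + d) U = U"
    using finite_param_word_set[OF U] by (subst takeWhile_eq_all_conv) auto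
  moreover have "takeWhile (\<lambda>i. i < k + d) (app k P U) = app k P U"
    using finite_param_word_set[OF finite_param_word_app[OF P U]]
    by (subst takeWhile_eq_all_conv) auto
  ultimately show ?thesis
    unfolding finite_app_def True by (simp only: map_subst_app[OF P])
next
  case False
  then obtain V t where V: "finite_param_word k (length u) V" "U = V @ (k + length u) # t"
    using finite_param_word_prefix[OF U] u by (metis le_neq_implies_less)
  have "takeWhile (\<lambda>i. i < k + length u) U = V"
    using finite_param_word_set[OF V(1)] unfolding V(2) by (intro takeWhile_word) simp
  moreover have "takeWhile (\<lambda>i. i < k + length u) (app k P U) = app k P V"
    using finite_param_word_set[OF finite_param_word_app[OF P V(1)]]
    unfolding V(2) app_append[OF P] by (intro takeWhile_word) simp
  ultimately show ?thesis by (simp add: finite_app_def map_subst_app[OF P])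
qed

section \<open>Envelopes\<close>

text \<open>Values are numbered in order of first appearance. The last clause ensures that stopping
  at any position leaves an initial segment of the parameters in use.\<close>

lemma first_occurrence_coding:
  "\<exists>f d. finite_param_word k d (map f cs) \<and> inj_on f (set cs) \<and> f ` set cs = {k..<k + d} \<and>
    (\<forall>m\<le>length cs. \<exists>j\<le>d. f ` set (take m cs) = {k..<k + j})"
proof (induction cs rule: rev_induct)
  case Nil
  show ?case by (intro exI[of _ undefined] exI[of _ 0]) auto
next
  case (snoc c cs)
  then obtain f d where f: "finite_param_word k d (map f cs)" "inj_on f (set cs)"
    "f ` set cs = {k..<k + d}" "\<forall>m\<le>length cs. \<exists>j\<le>d. f ` set (take m cs) = {k..<k + j}"
    by blast
  show ?case
  proof (cases "c \<in> set cs")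
    case True
    then have "f c \<in> {k..<k + d}" using f(3) by blast
    then have "finite_param_word k d (map f cs @ [f c])"
      by (intro finite_param_word_append f(1)) auto
    moreover have "\<exists>j\<le>d. f ` set (take m (cs @ [c])) = {k..<k + j}" if "m \<le> Suc (length cs)" for m
      using f(3,4) that True by (cases "m = Suc (length cs)") (auto simp: insert_absorb)
    ultimately show ?thesis
      using f(2,3) True by (intro exI[of _ f] exI[of _ d]) (auto simp: insert_absorb)
  next
    case False
    define g where "g = f(c := k + d)"
    have g: "map g cs = map f cs" "\<And>m. g ` set (take m cs) = f ` set (take m cs)"
      "g ` set cs = f ` set cs" "g c = k + d"
      using False by (auto simp: g_def dest: in_set_takeD)
    have img: "g ` set (cs @ [c]) = {k..<k + Suc d}"
      using f(3) g(3,4) by auto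
    have "map g (cs @ [c]) = map f cs @ (k + d) # []" using g(1,4) by simp
    moreover have "finite_param_word k (Suc d) (map f cs @ (k + d) # [])"
      unfolding finite_param_word.simps using f(1) by (intro exI conjI) auto
    ultimately have "finite_param_word k (Suc d) (map g (cs @ [c]))" by (simp only:)
    moreover have "inj_on g (set (cs @ [c]))"
    proof -
      have "inj_on g (set cs)"
        using f(2) False by (auto simp: g_def inj_on_def)
      moreover have "g c \<notin> g ` set cs" using f(3) g(3,4) by auto
      ultimately show ?thesis by auto
    qed
    moreover have "\<exists>j\<le>Suc d. g ` set (take m (cs @ [c])) = {k..<k + j}"
      if m: "m \<le> Suc (length cs)" for m
    proof (cases "m = Suc (length cs)")
      case True
      then show ?thesis using img by (intro exI[of _ "Suc d"]) simp
    next
      case False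
      with m have "m \<le> length cs" by simp
      moreover from this obtain j where "j \<le> d" "f ` set (take m cs) = {k..<k + j}"
        using f(4) by blast
      ultimately show ?thesis using g(2)[of m] by (intro exI[of _ j]) simp
    qed
    ultimately show ?thesis
      using img by (intro exI[of _ g] exI[of _ "Suc d"]) auto
  qed
qed

text \<open>The envelope of finitely many words: every position becomes a parameter, and two positions
  share a parameter iff all the words agree there, where a word that has already ended counts as a
  further value. The words ending at some position therefore end just before a new parameter.\<close>

lemma envelope:
  fixes x :: "'a \<Rightarrow> nat list"
  assumes "finite A" "\<And>a. a \<in> A \<Longrightarrow> word k (x a)"
  defines "B \<equiv> card {c. \<forall>a. (a \<in> A \<longrightarrow> c a \<in> insert None (Some ` {..<k})) \<and> (a \<notin> A \<longrightarrow> c a = None)}"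
  obtains d U u where "finite_param_word k d U" "d \<le> B"
    "\<And>a. a \<in> A \<Longrightarrow> word k (u a) \<and> length (u a) \<le> d \<and> x a = finite_app k U (u a)"
proof -
  define N where "N = (\<Sum>a\<in>A. length (x a))"
  have N: "length (x a) \<le> N" if "a \<in> A" for a
    unfolding N_def using assms(1) that by (intro member_le_sum) auto
  \<comment> \<open>The column of the tuple at position \<open>p\<close>, with \<open>None\<close>
    for a word that has ended. \<open>B\<close> counts the conceivable columns,
    \<open>(k + 1) ^ card A\<close> of them.\<close>
  define col where "col p = (\<lambda>a. if a \<in> A \<and> p < length (x a) then Some (x a ! p) else None)" for p
  define cs where "cs = map col [0..<N]"
  obtain f d where f: "finite_param_word k d (map f cs)" "inj_on f (set cs)"
    "f ` set cs = {k..<k + d}" "\<forall>m\<le>length cs. \<exists>j\<le>d. f ` set (take m cs) = {k..<k + j}"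
    using first_occurrence_coding[of k cs] by blast
  have letters: "x a ! p < k" if "a \<in> A" "p < length (x a)" for a p
    using assms(2)[OF that(1)] nth_mem[OF that(2)] by auto
  have "d = card (set cs)"
    using card_image[OF f(2)] f(3) by simp
  also have "\<dots> \<le> B"
    unfolding B_def
  proof (rule card_mono)
    show "finite {c. \<forall>a. (a \<in> A \<longrightarrow> c a \<in> insert None (Some ` {..<k})) \<and> (a \<notin> A \<longrightarrow> c a = None)}"
      using assms(1) by (intro finite_set_of_finite_funs) auto
    show "set cs \<subseteq> {c. \<forall>a. (a \<in> A \<longrightarrow> c a \<in> insert None (Some ` {..<k})) \<and> (a \<notin> A \<longrightarrow> c a = None)}"
      using letters by (auto simp: cs_def col_def)
  qed
  finally have dB: "d \<le> B" .
  have "\<exists>u. word k u \<and> length u \<le> d \<and> x a = finite_app k (map f cs) u" if a: "a \<in> A" for a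
  proof -
    define m where "m = length (x a)"
    have m: "m \<le> length cs" using N[OF a] by (simp add: m_def cs_def)
    then obtain j where j: "j \<le> d" "f ` set (take m cs) = {k..<k + j}"
      using f(4) by blast
    have take: "set (take m cs) = col ` {..<m}"
      using m by (auto simp: cs_def take_map)
    \<comment> \<open>Parameter \<open>k + i\<close> receives the letter of \<open>x a\<close> in
      the column it codes. For \<open>i < j\<close> this column occurs before \<open>x a\<close>
      ends, so \<open>the\<close> never meets \<open>None\<close>.\<close>
    define u where "u = map (\<lambda>i. the (inv_into (set cs) f (k + i) a)) [0..<j]"
    have pos: "\<exists>i<j. f (col p) = k + i \<and> u ! i = x a ! p" if p: "p < m" for p
    proof -
      have mem: "col p \<in> set cs"
        using p m by (auto simp: cs_def)
      have "f (col p) \<in> {k..<k + j}"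
        using p j(2) take by blast
      then obtain i where i: "i < j" "f (col p) = k + i"
        using that[of "f (col p) - k"] by auto
      have "inv_into (set cs) f (k + i) = col p"
        using inv_into_f_f[OF f(2) mem] i(2) by simp
      then show ?thesis using i p a by (auto simp: u_def col_def m_def)
    qed
    have len: "length u = j" by (simp add: u_def)
    have "word k u"
    proof
      fix l assume "l \<in> set u"
      then obtain i where i: "i < j" "l = u ! i" by (auto simp: in_set_conv_nth len)
      then have "k + i \<in> f ` col ` {..<m}" using j(2) take by auto
      then obtain p where "p < m" "f (col p) = k + i" by auto
      then have "u ! i = x a ! p" using pos[of p] by auto
      then show "l \<in> {..<k}" using i(2) letters[OF a] \<open>p < m\<close> by (simp add: m_def)
    qed
    moreover have "takeWhile (\<lambda>i. i < k + length u) (map f cs) = take m (map f cs)"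
    proof (rule takeWhile_eq_take_P_nth)
      fix p assume "p < m" "p < length (map f cs)"
      then show "map f cs ! p < k + length u"
        using pos[of p] by (auto simp: cs_def len)
    next
      \<comment> \<open>The column at \<open>m\<close> is the first with \<open>None\<close> at
        \<open>a\<close>, hence differs from all earlier ones and has a code of at least
        \<open>k + j\<close>.\<close>
      assume *: "m < length (map f cs)"
      show "\<not> map f cs ! m < k + length u"
      proof
        assume "map f cs ! m < k + length u"
        moreover have mem: "col m \<in> set cs" using * by (auto simp: cs_def)
        then have "f (col m) \<ge> k" using f(3) by auto
        ultimately have "f (col m) \<in> f ` set (take m cs)"
          using * j(2) by (auto simp: cs_def len)
        then have "col m \<in> set (take m cs)"
          using inj_on_image_mem_iff[OF f(2) mem set_take_subset] by blast
        then obtain p where "p < m" "col m = col p" using take by auto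
        then have "col m a = col p a" by simp
        with a \<open>p < m\<close> show False by (simp add: col_def m_def)
      qed
    qed
    moreover have "x a = map (subst k u) (take m (map f cs))"
    proof (rule nth_equalityI)
      show "length (x a) = length (map (subst k u) (take m (map f cs)))"
        using m by (simp add: m_def)
      fix p assume p: "p < length (x a)"
      then obtain i where "i < j" "f (col p) = k + i" "u ! i = x a ! p"
        using pos[of p] by (auto simp: m_def)
      then show "x a ! p = map (subst k u) (take m (map f cs)) ! p"
        using p m by (simp add: m_def cs_def)
    qed
    ultimately show ?thesis using j(1) len by (auto simp: finite_app_def)
  qed
  then obtain u where "\<And>a. a \<in> A \<Longrightarrow> word k (u a) \<and> length (u a) \<le> d \<and> x a = finite_app k (map f cs) (u a)"
    by metis
  with f(1) dB show thesis by (rule that)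
qed

section \<open>The order of words\<close>

text \<open>The letters \<open>0 < 1 < 2\<close> play the roles of \<open>L < X < R\<close>.\<close>

definition word_less :: "nat list \<Rightarrow> nat list \<Rightarrow> bool" where
  "word_less v w \<longleftrightarrow> (\<exists>i. i < length v \<and> i < length w \<and> v ! i = 0 \<and> w ! i = 2 \<and> (\<forall>j<i. v ! j \<le> w ! j))"

definition word_order :: "nat list binstruct" where
  "word_order = \<lparr>universe = {w. word 3 w},
     brel = {(v, w). word 3 v \<and> word 3 w \<and> (v = w \<or> word_less v w)}\<rparr>"

lemma word_less_asym: "word_less v w \<Longrightarrow> \<not> word_less w v"
proof
  assume "word_less v w" "word_less w v"
  then obtain i j where i: "v ! i = 0" "w ! i = 2" "\<forall>l<i. v ! l \<le> w ! l"
    and j: "w ! j = 0" "v ! j = 2" "\<forall>l<j. w ! l \<le> v ! l"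
    by (auto simp: word_less_def)
  show False
    using i j by (cases i j rule: linorder_cases) force+
qed

text \<open>The earlier of the two witnessing positions works, because \<open>0\<close> is the least
  letter and \<open>2\<close> the greatest.\<close>

lemma word_less_trans:
  assumes "word_less u v" "word_less v w" "word 3 u" "word 3 w"
  shows "word_less u w"
proof -
  obtain i where i: "i < length u" "i < length v" "u ! i = 0" "v ! i = 2" "\<forall>l<i. u ! l \<le> v ! l"
    using assms(1) by (auto simp: word_less_def)
  obtain j where j: "j < length v" "j < length w" "v ! j = 0" "w ! j = 2" "\<forall>l<j. v ! l \<le> w ! l"
    using assms(2) by (auto simp: word_less_def)
  consider "i < j" | "j < i" using i(4) j(3) by (cases i j rule: linorder_cases) auto
  then show ?thesis
  proof cases
    case 1
    have "w ! i \<in> set w" using 1 j(2) by auto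
    then have "w ! i < 3" using assms(4) by auto
    moreover have "w ! i \<ge> 2" using j(5) 1 i(4) by force
    ultimately have "w ! i = 2" by simp
    moreover have "\<forall>l<i. u ! l \<le> w ! l"
      using i(5) j(5) 1 by (meson order_trans less_trans)
    ultimately show ?thesis
      unfolding word_less_def using 1 i j by (intro exI[of _ i]) simp
  next
    case 2
    have "u ! j = 0" using i(5) 2 j(3) by force
    moreover have "\<forall>l<j. u ! l \<le> w ! l"
      using i(5) j(5) 2 by (meson order_trans less_trans)
    ultimately show ?thesis
      unfolding word_less_def using 2 i j by (intro exI[of _ j]) simp
  qed
qed

lemma partial_order_word_order: "partial_order word_order"
  unfolding partial_order_def partial_order_on_def preorder_on_def
proof (intro conjI)
  show "refl_on (universe word_order) (brel word_order)"
    by (auto simp: word_order_def refl_on_def)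
  show "brel word_order \<subseteq> universe word_order \<times> universe word_order"
    by (auto simp: word_order_def)
  show "trans (brel word_order)"
    by (rule transI) (auto simp: word_order_def intro: word_less_trans)
  show "antisym (brel word_order)"
    by (rule antisymI) (auto simp: word_order_def dest: word_less_asym)
qed

lemma param_word_var:
  assumes "param_word k P" "i < n"
  shows "length (P i) < length (P n)" "P n ! length (P i) = k + i"
proof -
  have "P n = P i @ (k + i) # tail i P (n - Suc i)"
    using param_word_append[OF assms(1), of i "n - Suc i"] assms(2) by simp
  then show "length (P i) < length (P n)" "P n ! length (P i) = k + i" by simp_all
qed

lemma param_word_nth:
  assumes "param_word k P" "i \<le> n" "p < length (P i)"
  shows "P n ! p = P i ! p" "P n ! p < k + i"
proof -
  show *: "P n ! p = P i ! p"
  proof (cases "i = n")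
    case False
    then have "P n = P i @ (k + i) # tail i P (n - Suc i)"
      using param_word_append[OF assms(1), of i "n - Suc i"] assms(2) by simp
    then show ?thesis using assms(3) by (simp add: nth_append)
  qed simp
  show "P n ! p < k + i"
    unfolding * using param_word_word[OF assms(1), of i] nth_mem[OF assms(3)] by blast
qed

lemma app_nth_var:
  assumes "param_word k P" "i < length u"
  shows "app k P u ! length (P i) = u ! i"
  using param_word_var[OF assms] by (simp add: app_def)

text \<open>A position present in both images carries either a constant, equal in both, or a
  parameter \<open>j\<close>, where they show \<open>u ! j\<close> and \<open>v ! j\<close>. A pair
  of letters \<open>0\<close>, \<open>2\<close> therefore comes from a parameter, and the first
  occurrences of the earlier parameters, which lie before it, compare \<open>u\<close> with
  \<open>v\<close> below that index.\<close>

lemma word_less_app: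
  assumes P: "param_word k P"
  shows "word_less (app k P u) (app k P v) \<longleftrightarrow> word_less u v"
proof
  assume "word_less u v"
  then obtain i where i: "i < length u" "i < length v" "u ! i = 0" "v ! i = 2" "\<forall>j<i. u ! j \<le> v ! j"
    by (auto simp: word_less_def)
  have "app k P u ! p \<le> app k P v ! p" if p: "p < length (P i)" for p
  proof -
    have len: "p < length (P (length u))" "p < length (P (length v))"
      using p param_word_var(1)[OF P i(1)] param_word_var(1)[OF P i(2)] by simp_all
    have "P (length u) ! p = P i ! p" "P (length v) ! p = P i ! p" "P i ! p < k + i"
      using param_word_nth[OF P less_imp_le[OF i(1)] p] param_word_nth[OF P less_imp_le[OF i(2)] p]
      by simp_all
    then show ?thesis
      using len i(5) by (auto simp: app_def subst_def)
  qed
  moreover have "length (P i) < length (app k P u)" "length (P i) < length (app k P v)"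
    using param_word_var(1)[OF P] i(1,2) by (simp_all add: app_def)
  moreover have "app k P u ! length (P i) = 0" "app k P v ! length (P i) = 2"
    using app_nth_var[OF P i(1)] app_nth_var[OF P i(2)] i(3,4) by simp_all
  ultimately show "word_less (app k P u) (app k P v)"
    unfolding word_less_def by blast
next
  assume "word_less (app k P u) (app k P v)"
  then obtain p where p: "p < length (P (length u))" "p < length (P (length v))"
    "app k P u ! p = 0" "app k P v ! p = 2" "\<forall>q<p. app k P u ! q \<le> app k P v ! q"
    by (auto simp: word_less_def app_def)
  define n where "n = min (length u) (length v)"
  have pn: "p < length (P n)" using p(1,2) by (simp add: n_def min_def)
  have eq: "P (length u) ! p = P n ! p" "P (length v) ! p = P n ! p" "P n ! p < k + n"
  proof -
    have "n \<le> length u" "n \<le> length v" by (simp_all add: n_def)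
    from param_word_nth(1)[OF P this(1) pn] param_word_nth(1)[OF P this(2) pn]
      param_word_nth(2)[OF P order.refl pn]
    show "P (length u) ! p = P n ! p" "P (length v) ! p = P n ! p" "P n ! p < k + n"
      by blast+
  qed
  have "\<not> P n ! p < k" using p eq by (auto simp: app_def)
  then have "P n ! p = k + (P n ! p - k)" "P n ! p - k < n" using eq(3) by auto
  then obtain i where i: "P n ! p = k + i" "i < n" ..
  have "length (P i) \<le> p"
    using param_word_nth(2)[OF P, of i n p] i by (cases "p < length (P i)") auto
  then have "u ! j \<le> v ! j" if "j < i" for j
    using p(5) param_word_var(1)[OF P that] app_nth_var[OF P, of j u] app_nth_var[OF P, of j v]
      that i(2) by (auto simp: n_def dest!: spec[of _ "length (P j)"])
  moreover have "u ! i = 0" "v ! i = 2"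
    using p eq i(1) by (auto simp: app_def)
  ultimately show "word_less u v"
    using i(2) unfolding word_less_def n_def by auto
qed

lemma inj_app:
  assumes P: "param_word k P" and eq: "app k P u = app k P v"
  shows "u = v"
proof (rule nth_equalityI)
  have "length (P (length u)) = length (P (length v))"
    using eq by (metis app_def length_map)
  then show len: "length u = length v"
    using param_word_var(1)[OF P, of "length u" "length v"]
      param_word_var(1)[OF P, of "length v" "length u"]
    by (metis less_irrefl linorder_neqE_nat)
  show "u ! i = v ! i" if "i < length u" for i
    using app_nth_var[OF P, of i u] app_nth_var[OF P, of i v] that eq len by simp
qed

lemma app_embedding:
  assumes "param_word 3 P"
  shows "restrict (app 3 P) (universe word_order) \<in> embeddings word_order word_order"
proof -
  have "word 3 (app 3 P w)" if "word 3 w" for w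
    using word_app[OF assms that] by simp
  then show ?thesis
    using word_less_app[OF assms] inj_app[OF assms]
    by (auto simp: embeddings_def word_order_def inj_on_def)
qed

lemma compose_embeddings:
  assumes "f \<in> embeddings A B" "g \<in> embeddings B C"
  shows "compose (universe A) g f \<in> embeddings A C"
proof -
  have "f x \<in> universe B" if "x \<in> universe A" for x
    using assms(1) that by (auto simp: embeddings_def)
  then show ?thesis
    using assms by (auto simp: embeddings_def compose_def inj_on_def PiE_iff)
qed

text \<open>The \<open>j\<close>-th element compares itself with the \<open>i\<close>-th one in the positions \<open>2 * i\<close> and
  \<open>2 * i + 1\<close>, where the latter carries \<open>LR\<close>: below is \<open>LL\<close>, above is \<open>RR\<close>,
  incomparable is \<open>XX\<close>.\<close>

definition code_letter :: "(nat \<Rightarrow> nat \<Rightarrow> bool) \<Rightarrow> nat \<Rightarrow> nat \<Rightarrow> nat" where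
  "code_letter le j p = (if p div 2 = j then (if even p then 0 else 2)
     else if le j (p div 2) then 0 else if le (p div 2) j then 2 else 1)"

definition code_word :: "(nat \<Rightarrow> nat \<Rightarrow> bool) \<Rightarrow> nat \<Rightarrow> nat list" where
  "code_word le j = map (code_letter le j) [0..<2 * j + 2]"

text \<open>If \<open>le a b\<close>, the witness is \<open>2 * a\<close> or
  \<open>2 * b + 1\<close>, in the block of the smaller index, and transitivity gives monotonicity
  in blocks of other elements. If \<open>a\<close> and \<open>b\<close> are incomparable, each has
  the letter \<open>1\<close> in the block of the other, so a witness would lie in the block of some
  \<open>c\<close> with \<open>le a c\<close> and \<open>le c b\<close>.\<close>

lemma code_word_less_iff:
  assumes trans: "\<And>a b c. le a b \<Longrightarrow> le b c \<Longrightarrow> le a c"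
    and antisym: "\<And>a b. le a b \<Longrightarrow> le b a \<Longrightarrow> a = b"
    and "a \<noteq> b"
  shows "word_less (code_word le a) (code_word le b) \<longleftrightarrow> le a b"
proof -
  have nth: "code_word le a ! p = code_letter le a p" if "p < 2 * a + 2" for a p
    using that by (simp add: code_word_def del: upt_Suc)
  have len: "length (code_word le a) = 2 * a + 2" for a
    by (simp add: code_word_def)
  have mono: "code_letter le a p \<le> code_letter le b p"
    if "le a b" "p div 2 \<noteq> a" "p div 2 \<noteq> b" for a b p
    using that trans[of a b "p div 2"] trans[of "p div 2" a b] by (auto simp: code_letter_def)
  have less: "word_less (code_word le a) (code_word le b)" if ab: "le a b" "a \<noteq> b" for a b
  proof (cases "a < b")
    case True
    have "\<not> le b a" using antisym ab by blast
    then have "code_letter le b (2 * a) = 2" using ab by (simp add: code_letter_def)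
    moreover have "code_letter le a (2 * a) = 0" by (simp add: code_letter_def)
    moreover have "code_letter le a p \<le> code_letter le b p" if "p < 2 * a" for p
      using that True by (intro mono[OF ab(1)]) auto
    ultimately show ?thesis
      unfolding word_less_def using True
      by (intro exI[of _ "2 * a"]) (auto simp: nth len)
  next
    case False
    then have "b < a" using ab by simp
    have 0: "code_letter le a p = 0" if "p div 2 = b" for p
      using ab that by (simp add: code_letter_def)
    have "code_letter le b (2 * b + 1) = 2" by (simp add: code_letter_def)
    moreover have "code_letter le a p \<le> code_letter le b p" if "p < 2 * b + 1" for p
    proof (cases "p div 2 = b")
      case False
      then show ?thesis using that \<open>b < a\<close> by (intro mono[OF ab(1)]) auto
    qed (simp add: 0)
    ultimately show ?thesis
      unfolding word_less_def using \<open>b < a\<close> 0[of "2 * b + 1"]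
      by (intro exI[of _ "2 * b + 1"]) (auto simp: nth len)
  qed
  have "le a b" if wl: "word_less (code_word le a) (code_word le b)"
  proof (rule ccontr)
    assume nab: "\<not> le a b"
    have nba: "\<not> le b a"
      using less[of b a] word_less_asym[OF wl] \<open>a \<noteq> b\<close> by blast
    obtain p where p: "p < 2 * a + 2" "p < 2 * b + 2" "code_letter le a p = 0" "code_letter le b p = 2"
      and le: "\<And>q. q < p \<Longrightarrow> code_letter le a q \<le> code_letter le b q"
      using wl unfolding word_less_def len by (auto simp: nth)
    have x: "code_letter le a q = 1" if "q div 2 = b" for q
      using that nab nba \<open>a \<noteq> b\<close> by (auto simp: code_letter_def)
    have y: "code_letter le b q = 1" if "q div 2 = a" for q
      using that nab nba \<open>a \<noteq> b\<close> by (auto simp: code_letter_def)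
    have "p div 2 \<noteq> b" using x[of p] p(3) by auto
    moreover have "p div 2 \<noteq> a" using y[of p] p(4) by auto
    ultimately have "le a (p div 2)" "le (p div 2) b"
      using p(3,4) by (auto simp: code_letter_def split: if_splits)
    then show False using trans nab by blast
  qed
  then show ?thesis using less \<open>a \<noteq> b\<close> by blast
qed

lemma countable_order_embeds:
  fixes Q :: "'a binstruct"
  assumes "partial_order Q" "countable (universe Q)"
  shows "embeddings Q word_order \<noteq> {}"
proof -
  define e where "e = to_nat_on (universe Q)"
  have inj: "inj_on e (universe Q)"
    unfolding e_def using assms(2) by (rule inj_on_to_nat_on)
  have po: "refl_on (universe Q) (brel Q)" "trans (brel Q)" "antisym (brel Q)"
    "brel Q \<subseteq> universe Q \<times> universe Q"
    using assms(1) by (auto simp: partial_order_def partial_order_on_def preorder_on_def)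
  define le where "le i j \<longleftrightarrow> (\<exists>x y. (x, y) \<in> brel Q \<and> i = e x \<and> j = e y)" for i j
  have le: "le (e x) (e y) \<longleftrightarrow> (x, y) \<in> brel Q" if "x \<in> universe Q" "y \<in> universe Q" for x y
    using that inj po(4) by (auto simp: le_def dest: inj_onD)
  have trans: "le i k" if jk: "le i j" "le j k" for i j k
  proof -
    obtain x y y' z where xy: "(x, y) \<in> brel Q" "i = e x" "j = e y"
      and yz: "(y', z) \<in> brel Q" "j = e y'" "k = e z"
      using jk by (auto simp: le_def)
    then have "y = y'" using inj po(4) by (auto dest: inj_onD)
    then have "(x, z) \<in> brel Q" using xy yz transD[OF po(2)] by blast
    then show ?thesis using xy yz unfolding le_def by blast
  qed
  have antisym: "i = j" if ji: "le i j" "le j i" for i j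
  proof -
    obtain x y y' x' where xy: "(x, y) \<in> brel Q" "i = e x" "j = e y"
      and yx: "(y', x') \<in> brel Q" "j = e y'" "i = e x'"
      using ji by (auto simp: le_def)
    then have "y = y'" "x = x'" using inj po(4) by (auto dest: inj_onD)
    then show ?thesis using xy yx antisymD[OF po(3)] by auto
  qed
  have word: "word 3 (code_word le j)" for j
    by (auto simp: code_word_def code_letter_def)
  have inj': "code_word le i = code_word le j \<Longrightarrow> i = j" for i j
    by (drule arg_cong[where f = length]) (simp add: code_word_def)
  have less: "word_less (code_word le (e x)) (code_word le (e y)) \<longleftrightarrow> (x, y) \<in> brel Q"
    if "x \<in> universe Q" "y \<in> universe Q" "x \<noteq> y" for x y
  proof -
    have "e x \<noteq> e y" using that inj by (auto dest: inj_onD)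
    then have "word_less (code_word le (e x)) (code_word le (e y)) \<longleftrightarrow> le (e x) (e y)"
      by (intro code_word_less_iff) (rule trans antisym, assumption+)+
    then show ?thesis using le that by simp
  qed
  have "(\<lambda>x\<in>universe Q. code_word le (e x)) \<in> embeddings Q word_order"
    unfolding embeddings_def
  proof (intro CollectI conjI ballI)
    show "inj_on (\<lambda>x\<in>universe Q. code_word le (e x)) (universe Q)"
      using inj inj' by (auto simp: inj_on_def)
    fix x y assume "x \<in> universe Q" "y \<in> universe Q"
    then show "(x, y) \<in> brel Q \<longleftrightarrow>
        ((\<lambda>x\<in>universe Q. code_word le (e x)) x, (\<lambda>x\<in>universe Q. code_word le (e x)) y) \<in> brel word_order"
      using less[of x y] word po(1) inj inj'[of "e x" "e y"]
      by (cases "x = y") (auto simp: word_order_def refl_on_def dest: inj_onD)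
  qed (use word in \<open>auto simp: word_order_def\<close>)
  then show ?thesis by blast
qed

section \<open>Big Ramsey degrees\<close>

theorem theorem1:
  fixes P :: "'a binstruct"
  assumes "universal_homogeneous_partial_order P"
  shows "finite_big_ramsey_degrees P"
  unfolding finite_big_ramsey_degrees_def
proof (intro allI impI)
  fix A :: "'a binstruct"
  assume fin: "finite (universe A)"
  have P: "partial_order P" "countable (universe P)" "universal_for_countable_orders P"
    using assms by (auto simp: universal_homogeneous_partial_order_def)
  obtain \<phi> where \<phi>: "\<phi> \<in> embeddings word_order P"
    using universal_embeds[OF P(3) partial_order_word_order] by auto
  obtain \<psi> where \<psi>: "\<psi> \<in> embeddings P word_order"
    using countable_order_embeds[OF P(1,2)] by auto
  define B where "B = card {c. \<forall>a. (a \<in> universe A \<longrightarrow> c a \<in> insert None (Some ` {..<3::nat})) \<and>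
    (a \<notin> universe A \<longrightarrow> c a = None)}"
  \<comment> \<open>All possible data: a dimension and the words substituted into the envelope.
    Their number bounds the degree independently of \<open>r\<close>.\<close>
  define I where "I = {..B} \<times> (universe A \<rightarrow>\<^sub>E {u. word 3 u \<and> length u \<le> B})"
  have finI: "finite I"
    unfolding I_def using fin by (intro finite_cartesian_product finite_PiE finite_words_le) auto
  have "arrows P P A r (enat (card I))" for r
    unfolding arrows_def
  proof (rule ballI)
    fix \<chi> assume \<chi>: "\<chi> \<in> embeddings A P \<rightarrow> {..<r}"
    define G where "G \<tau> w = (\<lambda>a\<in>universe A. \<phi> (finite_app 3 w (\<tau> a)))" for \<tau> w
    \<comment> \<open>The value \<open>r\<close> is an extra colour for the case that the data do
      not yield an embedding, which makes the colouring total.\<close>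
    define \<chi>' where "\<chi>' \<tau> w = (if G \<tau> w \<in> embeddings A P then \<chi> (G \<tau> w) else r)" for \<tau> w
    have "\<chi>' \<tau> w \<in> {..r}" for \<tau> w
      using \<chi> by (auto simp: \<chi>'_def Pi_iff less_imp_le)
    then obtain W where W: "param_word 3 W"
      and "\<forall>i\<in>I. \<exists>c. \<forall>w. finite_param_word 3 (fst i) w \<longrightarrow> \<chi>' (snd i) (app 3 W w) = c"
      using carlson_simpson_family[of 3 "{..r}" I "\<lambda>i. \<chi>' (snd i)" fst] finI by auto
    then obtain c where c: "\<And>i w. i \<in> I \<Longrightarrow> finite_param_word 3 (fst i) w \<Longrightarrow>
        \<chi>' (snd i) (app 3 W w) = c i"
      by metis
    define f where "f = compose (universe P) \<phi>
      (compose (universe P) (restrict (app 3 W) (universe word_order)) \<psi>)"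
    have f: "f \<in> embeddings P P"
      unfolding f_def by (intro compose_embeddings[OF _ \<phi>] compose_embeddings[OF \<psi>] app_embedding W)
    have "\<chi> (compose (universe A) f g) \<in> c ` I" if g: "g \<in> embeddings A P" for g
    proof -
      have gP: "g a \<in> universe P" if "a \<in> universe A" for a
        using g that by (auto simp: embeddings_def)
      have x: "word 3 (\<psi> (g a))" if "a \<in> universe A" for a
        using \<psi> gP[OF that] by (auto simp: embeddings_def word_order_def)
      obtain d U u where U: "finite_param_word 3 d U" "d \<le> B"
        and u: "\<And>a. a \<in> universe A \<Longrightarrow>
          word 3 (u a) \<and> length (u a) \<le> d \<and> \<psi> (g a) = finite_app 3 U (u a)"
        using envelope[OF fin, where k = 3 and x = "\<lambda>a. \<psi> (g a)"] x unfolding B_def by blast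
      define \<tau> where "\<tau> = restrict u (universe A)"
      have I: "(d, \<tau>) \<in> I"
        using U(2) u by (fastforce simp: I_def \<tau>_def)
      \<comment> \<open>\<open>app_finite_app\<close> moves \<open>W\<close> from the words of the
        tuple to their envelope.\<close>
      have "compose (universe A) f g = G \<tau> (app 3 W U)"
      proof
        fix a
        show "compose (universe A) f g a = G \<tau> (app 3 W U) a"
        proof (cases "a \<in> universe A")
          case True
          then show ?thesis
            using gP u x app_finite_app[OF W U(1), of "u a"]
            by (auto simp: G_def \<tau>_def f_def compose_def word_order_def)
        qed (simp add: G_def compose_def)
      qed
      moreover have "compose (universe A) f g \<in> embeddings A P"
        by (rule compose_embeddings[OF g f])
      ultimately have "\<chi> (compose (universe A) f g) = \<chi>' \<tau> (app 3 W U)"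
        by (simp add: \<chi>'_def)
      also have "\<dots> = c (d, \<tau>)"
        using c[OF I] U(1) by simp
      finally show ?thesis using I by blast
    qed
    then have "\<chi> ` {compose (universe A) f g | g. g \<in> embeddings A P} \<subseteq> c ` I"
      by blast
    then have "card (\<chi> ` {compose (universe A) f g | g. g \<in> embeddings A P}) \<le> card I"
      using finI by (meson card_image_le card_mono finite_imageI order_trans)
    then show "\<exists>f\<in>embeddings P P.
        enat (card (\<chi> ` {compose (universe A) f g | g. g \<in> embeddings A P})) \<le> enat (card I)"
      using f by auto
  qed
  then have "big_ramsey_degree A P \<le> enat (card I)"
    unfolding big_ramsey_degree_def by (intro Least_le allI)
  then show "big_ramsey_degree A P < \<infinity>"
    using enat_ord_simps(4) le_less_trans by blast
qed

end
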